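(* Let $K$ be an algebraically closed field, let $n\geq 4$, and let $d\geq 1$ be an integer with $d\leq 2\left\lfloor\frac{n}{4}\right\rfloor-1$. Then there are only finitely many conjugacy classes of irreducible representations $$\rho:\mathrm{Aut}(F_n)\rightarrow \mathrm{GL}_d(K).$$
   Context: $F_n$ is the free group of rank $n$ and $\mathrm{Aut}(F_n)$ its automorphism group. A representation $\rho:G\to\mathrm{GL}_d(K)$ is irreducible if $K^d$ has no $\rho(G)$-invariant linear subspaces other than $0$ and $K^d$; two representations are conjugate if they differ by conjugation by an element of $\mathrm{GL}_d(K)$. *)

theory Defs
  imports "HOL-Algebra.Bij" "Jordan_Normal_Form.VS_Connect"
begin

section \<open>The free group of rank \<open>n\<close>\<close>

text \<open>The letter \<open>(i, True)\<close> is the \<open>i\<close>-th free generator and \<open>(i, False)\<close> its formal inverse.\<close>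

type_synonym letter = "nat \<times> bool"

definition letter_inv :: "letter \<Rightarrow> letter" where
  "letter_inv x = (fst x, \<not> snd x)"

definition reduced :: "letter list \<Rightarrow> bool" where
  "reduced w \<longleftrightarrow> successively (\<lambda>x y. y \<noteq> letter_inv x) w"

fun cancel_cons :: "letter \<Rightarrow> letter list \<Rightarrow> letter list" where
  "cancel_cons x [] = [x]"
| "cancel_cons x (y # w) = (if y = letter_inv x then w else x # y # w)"

definition free_group :: "nat \<Rightarrow> letter list monoid" where
  "free_group n =
    \<lparr>carrier = {w. reduced w \<and> fst ` set w \<subseteq> {..<n}},
     mult = (\<lambda>u v. foldr cancel_cons u v),
     one = []\<rparr>"

lemma letter_inv_simps [simp]:
  "letter_inv (letter_inv x) = x" "fst (letter_inv x) = fst x"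
  "letter_inv x \<noteq> x" "x \<noteq> letter_inv x" "letter_inv x = letter_inv y \<longleftrightarrow> x = y"
  by (cases x; cases y; auto simp: letter_inv_def)+

lemma reduced_simps [simp]:
  "reduced []" "reduced [x]"
  "reduced (x # y # w) \<longleftrightarrow> y \<noteq> letter_inv x \<and> reduced (y # w)"
  by (auto simp: reduced_def)

lemma reduced_ConsD: "reduced (x # w) \<Longrightarrow> reduced w"
  by (cases w) auto

lemma reduced_cancel_cons: "reduced w \<Longrightarrow> reduced (cancel_cons x w)"
  by (cases w) (auto dest: reduced_ConsD)

lemma reduced_foldr_cancel_cons: "reduced v \<Longrightarrow> reduced (foldr cancel_cons u v)"
  by (induction u) (auto simp: reduced_cancel_cons)

lemma set_cancel_cons: "set (cancel_cons x w) \<subseteq> insert x (set w)"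
  by (cases w) auto

lemma set_foldr_cancel_cons: "set (foldr cancel_cons u v) \<subseteq> set u \<union> set v"
proof (induction u)
  case (Cons x u)
  then show ?case using set_cancel_cons[of x "foldr cancel_cons u v"] by auto
qed simp

lemma cancel_cons_reduced: "reduced (x # w) \<Longrightarrow> cancel_cons x w = x # w"
  by (cases w) auto

lemma cancel_cons_inverse: "reduced w \<Longrightarrow> cancel_cons x (cancel_cons (letter_inv x) w) = w"
proof (cases w)
  case (Cons y v)
  assume "reduced w"
  then show ?thesis using Cons by (auto intro: cancel_cons_reduced)
qed simp

lemma foldr_cancel_cons_cancel_cons:
  assumes "reduced w"
  shows "foldr cancel_cons (cancel_cons x v) w = cancel_cons x (foldr cancel_cons v w)"
proof (cases v)
  case (Cons y v')
  then show ?thesis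
    using cancel_cons_inverse[OF reduced_foldr_cancel_cons[OF assms, of v'], of x] by auto
qed simp

lemma foldr_cancel_cons_assoc:
  assumes "reduced w"
  shows "foldr cancel_cons (foldr cancel_cons u v) w = foldr cancel_cons u (foldr cancel_cons v w)"
  by (induction u) (auto simp: foldr_cancel_cons_cancel_cons[OF assms])

lemma foldr_cancel_cons_left_inverse: "foldr cancel_cons (rev (map letter_inv u)) u = []"
  by (induction u) auto

lemma reduced_inverse: "reduced u \<Longrightarrow> reduced (rev (map letter_inv u))"
  unfolding reduced_def successively_rev successively_map
  by (erule successively_mono) (metis letter_inv_simps(1))

theorem group_free_group: "group (free_group n)"
proof (rule groupI)
  fix u v assume "u \<in> carrier (free_group n)" "v \<in> carrier (free_group n)"
  then show "u \<otimes>\<^bsub>free_group n\<^esub> v \<in> carrier (free_group n)"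
    using set_foldr_cancel_cons[of u v] unfolding free_group_def
    by (simp add: reduced_foldr_cancel_cons) blast
next
  fix u assume u: "u \<in> carrier (free_group n)"
  show "\<exists>v \<in> carrier (free_group n). v \<otimes>\<^bsub>free_group n\<^esub> u = \<one>\<^bsub>free_group n\<^esub>"
    using u by (intro bexI[of _ "rev (map letter_inv u)"])
      (auto simp: free_group_def foldr_cancel_cons_left_inverse reduced_inverse)
qed (auto simp: free_group_def foldr_cancel_cons_assoc)

subsection \<open>Universal property\<close>

definition eval_letter :: "('g, 'b) monoid_scheme \<Rightarrow> (nat \<Rightarrow> 'g) \<Rightarrow> letter \<Rightarrow> 'g" where
  "eval_letter G f x = (if snd x then f (fst x) else inv\<^bsub>G\<^esub> f (fst x))"

definition eval_word :: "('g, 'b) monoid_scheme \<Rightarrow> (nat \<Rightarrow> 'g) \<Rightarrow> letter list \<Rightarrow> 'g" where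
  "eval_word G f w = foldr (\<lambda>x g. eval_letter G f x \<otimes>\<^bsub>G\<^esub> g) w \<one>\<^bsub>G\<^esub>"

lemma eval_word_simps [simp]:
  "eval_word G f [] = \<one>\<^bsub>G\<^esub>"
  "eval_word G f (x # w) = eval_letter G f x \<otimes>\<^bsub>G\<^esub> eval_word G f w"
  by (auto simp: eval_word_def)

theorem free_group_universal:
  assumes "group G" and f: "f \<in> {..<n} \<rightarrow> carrier G"
  shows "\<exists>!h. h \<in> hom (free_group n) G \<inter> extensional (carrier (free_group n)) \<and>
              (\<forall>i<n. h [(i, True)] = f i)"
proof -
  interpret group G by fact
  let ?F = "free_group n" and ?e = "eval_word G f"
  interpret F: group ?F by (rule group_free_group)
  have letter: "eval_letter G f x \<in> carrier G" if "fst x < n" for x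
    using f that by (auto simp: eval_letter_def)
  have closed: "?e w \<in> carrier G" if "fst ` set w \<subseteq> {..<n}" for w
    using that by (induction w) (auto simp: letter)
  have cancel: "?e (cancel_cons x w) = eval_letter G f x \<otimes>\<^bsub>G\<^esub> ?e w"
    if "fst x < n" "fst ` set w \<subseteq> {..<n}" for x w
  proof (cases w)
    case (Cons y v)
    have "f (fst x) \<in> carrier G" using f that by auto
    then show ?thesis
      using Cons that closed[of v]
      by (auto simp: eval_letter_def letter_inv_def m_assoc[symmetric])
  qed simp
  have mult: "?e (foldr cancel_cons u v) = ?e u \<otimes>\<^bsub>G\<^esub> ?e v"
    if "fst ` set u \<subseteq> {..<n}" "fst ` set v \<subseteq> {..<n}" for u v
    using that(1)
  proof (induction u)
    case (Cons x u)
    have "fst ` set (foldr cancel_cons u v) \<subseteq> {..<n}"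
      using set_foldr_cancel_cons[of u v] Cons.prems that(2) by (simp add: image_subset_iff) blast
    then show ?case using Cons that(2) by (auto simp: cancel closed letter m_assoc)
  qed (simp add: closed that)
  let ?h = "restrict ?e (carrier ?F)"
  show ?thesis
  proof (rule ex1I[of _ ?h], intro conjI)
    have "?h \<in> hom ?F G"
    proof (rule homI)
      fix u v assume uv: "u \<in> carrier ?F" "v \<in> carrier ?F"
      then have "u \<otimes>\<^bsub>?F\<^esub> v \<in> carrier ?F" by simp
      then show "?h (u \<otimes>\<^bsub>?F\<^esub> v) = ?h u \<otimes>\<^bsub>G\<^esub> ?h v"
        using uv mult[of u v] by (auto simp: free_group_def)
    qed (auto simp: free_group_def intro!: closed)
    then show "?h \<in> hom ?F G \<inter> extensional (carrier ?F)" by simp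
    show "\<forall>i<n. ?h [(i, True)] = f i"
      using f by (auto simp: free_group_def eval_letter_def Pi_iff)
  next
    fix h assume h: "h \<in> hom ?F G \<inter> extensional (carrier ?F) \<and> (\<forall>i<n. h [(i, True)] = f i)"
    then interpret h: group_hom ?F G h by unfold_locales auto
    have hl: "h [x] = eval_letter G f x" if x: "fst x < n" for x
    proof (cases "snd x")
      case True
      then show ?thesis using h x by (cases x) (auto simp: eval_letter_def)
    next
      case False
      have "inv\<^bsub>?F\<^esub> [(fst x, True)] = [x]"
        using x False by (intro F.inv_equality) (auto simp: free_group_def letter_inv_def)
      moreover have "h (inv\<^bsub>?F\<^esub> [(fst x, True)]) = inv\<^bsub>G\<^esub> (h [(fst x, True)])"
        using x by (intro h.hom_inv) (auto simp: free_group_def)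
      ultimately show ?thesis using h x False by (auto simp: eval_letter_def)
    qed
    have "h w = ?e w" if "w \<in> carrier ?F" for w
      using that
    proof (induction w)
      case Nil
      then show ?case using h.hom_one by (simp add: free_group_def)
    next
      case (Cons x w)
      have x: "[x] \<in> carrier ?F" "fst x < n" and w: "w \<in> carrier ?F"
        using Cons.prems by (auto simp: free_group_def dest: reduced_ConsD)
      have "x # w = [x] \<otimes>\<^bsub>?F\<^esub> w"
        using Cons.prems by (auto simp: free_group_def cancel_cons_reduced)
      then have "h (x # w) = h [x] \<otimes>\<^bsub>G\<^esub> h w" using x w by (metis h.hom_mult)
      then show ?case using Cons.IH[OF w] hl[OF x(2)] by simp
    qed
    then show "h = ?h" using h by (auto simp: extensional_def fun_eq_iff)
  qed
qed

section \<open>Representations\<close>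

definition GL :: "'k::field itself \<Rightarrow> nat \<Rightarrow> 'k mat monoid" where
  "GL ty d = units_of (ring_mat ty d ())"

lemma group_GL: "group (GL TYPE('k::field) d)"
proof -
  interpret ring "ring_mat TYPE('k) d ()" by (rule ring_mat)
  show ?thesis unfolding GL_def by (rule units_group)
qed

definition irreducible_rep ::
  "('g, 'b) monoid_scheme \<Rightarrow> nat \<Rightarrow> ('g \<Rightarrow> 'k::field mat) \<Rightarrow> bool" where
  "irreducible_rep G d \<rho> \<longleftrightarrow>
     \<rho> \<in> hom G (GL TYPE('k) d) \<and>
     (\<forall>W. subspace class_ring W (module_vec TYPE('k) d) \<and>
          (\<forall>g \<in> carrier G. \<forall>w \<in> W. \<rho> g *\<^sub>v w \<in> W)
          \<longrightarrow> W = {0\<^sub>v d} \<or> W = carrier_vec d)"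

text \<open>Elements of \<^term>\<open>hom G H\<close> take arbitrary values outside \<^term>\<open>carrier G\<close>. The
  relation below compares representations on \<^term>\<open>carrier G\<close> only, so its classes correspond
  to the conjugacy classes of the actual maps from \<^term>\<open>carrier G\<close> to \<open>GL\<^sub>d(K)\<close>.\<close>

definition conjugate_reps ::
  "('g, 'b) monoid_scheme \<Rightarrow> nat \<Rightarrow> ('g \<Rightarrow> 'k::field mat) \<Rightarrow> ('g \<Rightarrow> 'k mat) \<Rightarrow> bool" where
  "conjugate_reps G d \<rho> \<sigma> \<longleftrightarrow>
     (\<exists>P \<in> carrier (GL TYPE('k) d). \<forall>g \<in> carrier G.
        \<sigma> g = P \<otimes>\<^bsub>GL TYPE('k) d\<^esub> \<rho> g \<otimes>\<^bsub>GL TYPE('k) d\<^esub> inv\<^bsub>GL TYPE('k) d\<^esub> P)"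

definition irreps :: "('g, 'b) monoid_scheme \<Rightarrow> nat \<Rightarrow> ('g \<Rightarrow> 'k::field mat) set" where
  "irreps G d = {\<rho>. irreducible_rep G d \<rho>}"

definition irreps_conj :: "('g, 'b) monoid_scheme \<Rightarrow> nat \<Rightarrow> ('g \<Rightarrow> 'k::field mat) rel" where
  "irreps_conj G d = {(\<rho>, \<sigma>) \<in> irreps G d \<times> irreps G d. conjugate_reps G d \<rho> \<sigma>}"

lemma equiv_irreps_conj:
  "equiv (irreps G d) (irreps_conj G d :: ('g \<Rightarrow> 'k::field mat) rel)"
proof -
  let ?GL = "GL TYPE('k) d"
  interpret GL: group ?GL by (rule group_GL)
  have closed: "\<rho> g \<in> carrier ?GL"
    if "\<rho> \<in> irreps G d" "g \<in> carrier G" for \<rho> :: "'g \<Rightarrow> 'k mat" and g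
    using that by (auto simp: irreps_def irreducible_rep_def hom_def)
  show ?thesis
  proof (rule equivI)
    show "irreps_conj G d \<subseteq> irreps G d \<times> (irreps G d :: ('g \<Rightarrow> 'k mat) set)"
      by (auto simp: irreps_conj_def)
    show "refl_on (irreps G d) (irreps_conj G d :: ('g \<Rightarrow> 'k mat) rel)"
      by (auto simp: refl_on_def irreps_conj_def conjugate_reps_def closed
          intro!: bexI[of _ "\<one>\<^bsub>?GL\<^esub>"])
    show "sym (irreps_conj G d :: ('g \<Rightarrow> 'k mat) rel)"
    proof (rule symI)
      fix \<rho> \<sigma> :: "'g \<Rightarrow> 'k mat" assume rs: "(\<rho>, \<sigma>) \<in> irreps_conj G d"
      then obtain P where P: "P \<in> carrier ?GL"
        "\<And>g. g \<in> carrier G \<Longrightarrow> \<sigma> g = P \<otimes>\<^bsub>?GL\<^esub> \<rho> g \<otimes>\<^bsub>?GL\<^esub> inv\<^bsub>?GL\<^esub> P"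
        by (auto simp: irreps_conj_def conjugate_reps_def)
      have "\<rho> g = inv\<^bsub>?GL\<^esub> P \<otimes>\<^bsub>?GL\<^esub> \<sigma> g \<otimes>\<^bsub>?GL\<^esub> inv\<^bsub>?GL\<^esub> (inv\<^bsub>?GL\<^esub> P)" if "g \<in> carrier G" for g
      proof -
        have "\<rho> g \<in> carrier ?GL" using rs that by (auto simp: irreps_conj_def closed)
        then show ?thesis using P that by (simp add: GL.m_assoc GL.inv_solve_left)
      qed
      then show "(\<sigma>, \<rho>) \<in> irreps_conj G d"
        using rs P(1) unfolding irreps_conj_def conjugate_reps_def
        by (auto intro!: bexI[of _ "inv\<^bsub>?GL\<^esub> P"])
    qed
    show "trans (irreps_conj G d :: ('g \<Rightarrow> 'k mat) rel)"
    proof (rule transI)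
      fix \<rho> \<sigma> \<tau> :: "'g \<Rightarrow> 'k mat"
      assume rs: "(\<rho>, \<sigma>) \<in> irreps_conj G d" and st: "(\<sigma>, \<tau>) \<in> irreps_conj G d"
      obtain P where P: "P \<in> carrier ?GL"
        "\<And>g. g \<in> carrier G \<Longrightarrow> \<sigma> g = P \<otimes>\<^bsub>?GL\<^esub> \<rho> g \<otimes>\<^bsub>?GL\<^esub> inv\<^bsub>?GL\<^esub> P"
        using rs by (auto simp: irreps_conj_def conjugate_reps_def)
      obtain Q where Q: "Q \<in> carrier ?GL"
        "\<And>g. g \<in> carrier G \<Longrightarrow> \<tau> g = Q \<otimes>\<^bsub>?GL\<^esub> \<sigma> g \<otimes>\<^bsub>?GL\<^esub> inv\<^bsub>?GL\<^esub> Q"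
        using st by (auto simp: irreps_conj_def conjugate_reps_def)
      have "\<tau> g = (Q \<otimes>\<^bsub>?GL\<^esub> P) \<otimes>\<^bsub>?GL\<^esub> \<rho> g \<otimes>\<^bsub>?GL\<^esub> inv\<^bsub>?GL\<^esub> (Q \<otimes>\<^bsub>?GL\<^esub> P)"
        if "g \<in> carrier G" for g
      proof -
        have "\<rho> g \<in> carrier ?GL" using rs that by (auto simp: irreps_conj_def closed)
        then show ?thesis using P Q that by (simp add: GL.m_assoc GL.inv_mult_group)
      qed
      then show "(\<rho>, \<tau>) \<in> irreps_conj G d"
        using rs st P(1) Q(1) unfolding irreps_conj_def conjugate_reps_def
        by (auto intro!: bexI[of _ "Q \<otimes>\<^bsub>?GL\<^esub> P"])
    qed
  qed
qed

end

theory Submission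
  imports Defs
begin

text \<open>
  Let \<open>q\<close> be 2, or 3 in characteristic 2. Splitting the generators into \<open>n div 2\<close> pairs and letting
  an automorphism of order \<open>q\<close> act on each pair gives a subgroup \<open>(\<int>/q)\<^bsup>n div 2\<^esup>\<close> of \<open>Aut(F\<^sub>n)\<close>.
  Commuting \<open>d \<times> d\<close> matrices of order dividing \<open>q\<close> are simultaneously diagonalisable, so there are
  at most \<open>q\<^sup>d\<close> of them. As \<open>d < n div 2\<close> (for \<open>n \<ge> 8\<close>), a representation \<open>\<rho>\<close> kills some \<open>g \<noteq> 1\<close>
  of this subgroup. If \<open>g\<close> sends a generator \<open>u\<close> to its partner \<open>u'\<close>, then the transvection
  \<open>z \<mapsto> u z\<close> has the same image as its conjugate by \<open>g\<close>, which multiplies by \<open>u'\<close> instead and hence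
  commutes with \<open>u \<mapsto> w u\<close>. The commutator of these two transvections is the transvection
  \<open>z \<mapsto> w z\<close>, so \<open>\<rho>\<close> kills it, and then all transvections. For \<open>n < 8\<close> we have \<open>d = 1\<close> and
  the images commute anyway. By Nielsen's theorem transvections and inversions of generators generate
  \<open>Aut(F\<^sub>n)\<close>, and the inversions are conjugate modulo transvections; so the image of \<open>\<rho>\<close> consists
  of \<open>1\<close> and one involution, which is \<open>\<plusminus>1\<close> by irreducibility. There are at most two classes.
\<close>

section \<open>Free groups and their automorphisms\<close>

abbreviation gen :: "nat \<Rightarrow> letter list" where
  "gen i \<equiv> [(i, True)]"

definition word_inv :: "letter list \<Rightarrow> letter list" where
  "word_inv u = rev (map letter_inv u)"

abbreviation Aut :: "nat \<Rightarrow> (letter list \<Rightarrow> letter list) monoid" where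
  "Aut n \<equiv> AutoGroup (free_group n)"

lemma carrier_free_group: "w \<in> carrier (free_group n) \<longleftrightarrow> reduced w \<and> fst ` set w \<subseteq> {..<n}"
  by (simp add: free_group_def)

lemma mult_free_group: "u \<otimes>\<^bsub>free_group n\<^esub> v = foldr cancel_cons u v"
  by (simp add: free_group_def)

lemma one_free_group: "\<one>\<^bsub>free_group n\<^esub> = []"
  by (simp add: free_group_def)

lemma word_inv_word_inv [simp]: "word_inv (word_inv u) = u"
  by (simp add: word_inv_def rev_map o_def)

lemma length_word_inv [simp]: "length (word_inv u) = length u"
  by (simp add: word_inv_def)

lemma fst_set_word_inv [simp]: "fst ` set (word_inv u) = fst ` set u"
  by (simp add: word_inv_def image_image)

lemma reduced_word_inv: "reduced u \<Longrightarrow> reduced (word_inv u)"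
  by (simp add: word_inv_def reduced_inverse)

lemma word_inv_closed: "u \<in> carrier (free_group n) \<Longrightarrow> word_inv u \<in> carrier (free_group n)"
  by (simp add: carrier_free_group reduced_word_inv)

lemma inv_free_group: "u \<in> carrier (free_group n) \<Longrightarrow> inv\<^bsub>free_group n\<^esub> u = word_inv u"
  using foldr_cancel_cons_left_inverse[of u]
  by (intro group.inv_equality[OF group_free_group])
    (simp_all add: word_inv_closed mult_free_group one_free_group word_inv_def[symmetric])

lemma letter_closed: "fst x < n \<Longrightarrow> [x] \<in> carrier (free_group n)"
  by (simp add: carrier_free_group)

lemma gen_closed: "i < n \<Longrightarrow> gen i \<in> carrier (free_group n)"
  by (simp add: carrier_free_group)

lemma group_Aut: "group (Aut n)"
  by (rule group.AutoGroup[OF group_free_group])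

lemma carrier_Aut: "carrier (Aut n) =
    hom (free_group n) (free_group n) \<inter> Bij (carrier (free_group n))"
  by (simp add: AutoGroup_def auto_def)

lemma Aut_hom: "\<phi> \<in> carrier (Aut n) \<Longrightarrow> group_hom (free_group n) (free_group n) \<phi>"
  by (simp add: carrier_Aut group_hom_def group_hom_axioms_def group_free_group)

lemma Aut_closed:
  "\<phi> \<in> carrier (Aut n) \<Longrightarrow> u \<in> carrier (free_group n) \<Longrightarrow> \<phi> u \<in> carrier (free_group n)"
  by (rule group_hom.hom_closed[OF Aut_hom])

lemma Aut_mult: "\<phi> \<in> carrier (Aut n) \<Longrightarrow> u \<in> carrier (free_group n) \<Longrightarrow>
    v \<in> carrier (free_group n) \<Longrightarrow> \<phi> (foldr cancel_cons u v) = foldr cancel_cons (\<phi> u) (\<phi> v)"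
  using group_hom.hom_mult[OF Aut_hom] by (metis mult_free_group)

lemma Aut_word_inv: "\<phi> \<in> carrier (Aut n) \<Longrightarrow> u \<in> carrier (free_group n) \<Longrightarrow>
    \<phi> (word_inv u) = word_inv (\<phi> u)"
  using group_hom.hom_inv[OF Aut_hom] by (metis inv_free_group Aut_closed)

lemma Aut_Nil: "\<phi> \<in> carrier (Aut n) \<Longrightarrow> \<phi> [] = []"
  using group_hom.hom_one[OF Aut_hom] by (metis one_free_group)

lemma Aut_inj: "\<phi> \<in> carrier (Aut n) \<Longrightarrow> inj_on \<phi> (carrier (free_group n))"
  by (simp add: carrier_Aut Bij_def bij_betw_def)

lemma mult_Aut_apply:
  assumes "\<phi> \<in> carrier (Aut n)" "\<psi> \<in> carrier (Aut n)" "u \<in> carrier (free_group n)"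
  shows "(\<phi> \<otimes>\<^bsub>Aut n\<^esub> \<psi>) u = \<phi> (\<psi> u)"
  using assms by (simp add: AutoGroup_def auto_def BijGroup_def compose_def)

lemma one_Aut_apply: "u \<in> carrier (free_group n) \<Longrightarrow> \<one>\<^bsub>Aut n\<^esub> u = u"
  by (simp add: AutoGroup_def BijGroup_def)

lemma inv_Aut_apply:
  assumes "\<phi> \<in> carrier (Aut n)" "u \<in> carrier (free_group n)"
  shows "(inv\<^bsub>Aut n\<^esub> \<phi>) (\<phi> u) = u" "\<phi> ((inv\<^bsub>Aut n\<^esub> \<phi>) u) = u"
proof -
  interpret A: group "Aut n" by (rule group_Aut)
  show "(inv\<^bsub>Aut n\<^esub> \<phi>) (\<phi> u) = u" "\<phi> ((inv\<^bsub>Aut n\<^esub> \<phi>) u) = u"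
    using mult_Aut_apply[of "inv\<^bsub>Aut n\<^esub> \<phi>" n \<phi> u] mult_Aut_apply[of \<phi> n "inv\<^bsub>Aut n\<^esub> \<phi>" u] assms
      one_Aut_apply[OF assms(2)] by simp_all
qed

section \<open>Endomorphisms prescribed on the generators\<close>

lemma free_hom_unique:
  assumes "h \<in> hom (free_group n) (free_group n) \<inter> extensional (carrier (free_group n))"
    and "h' \<in> hom (free_group n) (free_group n) \<inter> extensional (carrier (free_group n))"
    and "\<And>i. i < n \<Longrightarrow> h (gen i) = h' (gen i)"
  shows "h = h'"
proof -
  let ?P = "\<lambda>k. k \<in> hom (free_group n) (free_group n) \<inter> extensional (carrier (free_group n)) \<and>
    (\<forall>i<n. k (gen i) = h (gen i))"
  have "(\<lambda>i. h (gen i)) \<in> {..<n} \<rightarrow> carrier (free_group n)"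
    using assms(1) by (auto simp: hom_def Pi_iff gen_closed)
  then have "\<exists>!k. ?P k" by (rule free_group_universal[OF group_free_group])
  then obtain k where "\<And>k'. ?P k' \<Longrightarrow> k' = k" by (rule ex1E) blast
  from this[of h] this[of h'] show ?thesis using assms by auto
qed

lemma Aut_eqI:
  assumes \<phi>: "\<phi> \<in> carrier (Aut n)" and \<psi>: "\<psi> \<in> carrier (Aut n)"
    and eq: "\<And>i. i < n \<Longrightarrow> \<phi> (gen i) = \<psi> (gen i)"
  shows "\<phi> = \<psi>"
  using assms by (intro free_hom_unique[of \<phi> n \<psi>]) (auto simp: carrier_Aut Bij_def)

text \<open>Restricting to the carrier makes the map extensional, as membership in
  \<open>Bij\<close> and uniqueness in the universal property require.\<close>

definition free_endo :: "nat \<Rightarrow> (nat \<Rightarrow> letter list) \<Rightarrow> letter list \<Rightarrow> letter list" where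
  "free_endo n f = restrict (eval_word (free_group n) f) (carrier (free_group n))"

lemma eval_letter_free:
  "f (fst x) \<in> carrier (free_group n) \<Longrightarrow>
   eval_letter (free_group n) f x = (if snd x then f (fst x) else word_inv (f (fst x)))"
  by (simp add: eval_letter_def inv_free_group)

lemma free_endo_hom:
  assumes f: "f \<in> {..<n} \<rightarrow> carrier (free_group n)"
  shows "free_endo n f \<in> hom (free_group n) (free_group n) \<inter> extensional (carrier (free_group n))"
    and "\<And>i. i < n \<Longrightarrow> free_endo n f (gen i) = f i"
proof -
  let ?F = "free_group n"
  interpret F: group ?F by (rule group_free_group)
  obtain h where h: "h \<in> hom ?F ?F \<inter> extensional (carrier ?F)" "\<And>i. i < n \<Longrightarrow> h (gen i) = f i"
    using free_group_universal[OF group_free_group f] by blast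
  interpret h: group_hom ?F ?F h using h by unfold_locales auto
  have hl: "h [x] = eval_letter ?F f x" if x: "fst x < n" for x
  proof (cases "snd x")
    case True
    then show ?thesis using h x by (cases x) (auto simp: eval_letter_def)
  next
    case False
    have "[x] = inv\<^bsub>?F\<^esub> (gen (fst x))"
      using x False by (cases x) (simp add: inv_free_group gen_closed word_inv_def letter_inv_def)
    then show ?thesis using h.hom_inv[of "gen (fst x)"] h(2)[OF x] x False
      by (simp add: eval_letter_def gen_closed)
  qed
  have "h w = eval_word ?F f w" if "w \<in> carrier ?F" for w
    using that
  proof (induction w)
    case Nil
    then show ?case using h.hom_one by (simp add: one_free_group)
  next
    case (Cons x w)
    have x: "[x] \<in> carrier ?F" "fst x < n" and w: "w \<in> carrier ?F"
      using Cons.prems by (auto simp: free_group_def dest: reduced_ConsD)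
    have "x # w = [x] \<otimes>\<^bsub>?F\<^esub> w"
      using Cons.prems by (auto simp: free_group_def cancel_cons_reduced)
    then have "h (x # w) = h [x] \<otimes>\<^bsub>?F\<^esub> h w" using x w by (metis h.hom_mult)
    then show ?case using Cons.IH[OF w] hl[OF x(2)] by simp
  qed
  then have "h = free_endo n f"
    using h(1) by (auto simp: free_endo_def extensional_def fun_eq_iff)
  then show "free_endo n f \<in> hom ?F ?F \<inter> extensional (carrier ?F)"
    "\<And>i. i < n \<Longrightarrow> free_endo n f (gen i) = f i" using h by auto
qed

text \<open>Word reversal takes the place of the group inverse, so that the simplifier can evaluate
  the map on explicit words.\<close>

lemma free_endo_apply:
  assumes "f \<in> {..<n} \<rightarrow> carrier (free_group n)" "w \<in> carrier (free_group n)"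
  shows "free_endo n f w =
    foldr (\<lambda>x g. foldr cancel_cons (if snd x then f (fst x) else word_inv (f (fst x))) g) w []"
proof -
  have "eval_word (free_group n) f w =
    foldr (\<lambda>x g. foldr cancel_cons (if snd x then f (fst x) else word_inv (f (fst x))) g) w []"
    if "fst ` set w \<subseteq> {..<n}"
    using that
  proof (induction w)
    case (Cons x w)
    then have "f (fst x) \<in> carrier (free_group n)" using assms(1) by auto
    with Cons show ?case by (simp add: eval_letter_free mult_free_group)
  qed (simp add: one_free_group)
  with assms(2) show ?thesis by (simp add: free_endo_def carrier_free_group)
qed

text \<open>Both composites are extensional homomorphisms that fix every generator, hence the
  identity by uniqueness. Bijectivity thus becomes a check on generators.\<close>

lemma free_endo_Aut:
  assumes f: "f \<in> {..<n} \<rightarrow> carrier (free_group n)" and g: "g \<in> {..<n} \<rightarrow> carrier (free_group n)"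
    and fg: "\<And>i. i < n \<Longrightarrow> free_endo n f (g i) = gen i"
    and gf: "\<And>i. i < n \<Longrightarrow> free_endo n g (f i) = gen i"
  shows "free_endo n f \<in> carrier (Aut n)"
proof -
  let ?F = "free_group n" and ?f = "free_endo n f" and ?g = "free_endo n g"
  interpret F: group ?F by (rule group_free_group)
  note F = free_endo_hom[OF f] and G = free_endo_hom[OF g]
  have inv: "compose (carrier ?F) p q = restrict id (carrier ?F)"
    if "p \<in> hom ?F ?F" "q \<in> hom ?F ?F" "\<And>i. i < n \<Longrightarrow> p (q (gen i)) = gen i" for p q
  proof -
    have "compose (carrier ?F) p q \<in> hom ?F ?F \<inter> extensional (carrier ?F)"
      using that F.hom_compose[OF that(2,1)] by simp
    moreover have "restrict id (carrier ?F) \<in> hom ?F ?F \<inter> extensional (carrier ?F)"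
      using F.id_in_auto by (simp add: auto_def id_def)
    ultimately show ?thesis
      using that(3) by (intro free_hom_unique[where n = n]) (auto simp: compose_def gen_closed)
  qed
  have fg': "?f (?g w) = w" and gf': "?g (?f w) = w" if "w \<in> carrier ?F" for w
  proof -
    have "compose (carrier ?F) ?f ?g w = restrict id (carrier ?F) w"
      using inv[of ?f ?g] F G fg by simp
    then show "?f (?g w) = w" using that by (simp add: compose_def)
    have "compose (carrier ?F) ?g ?f w = restrict id (carrier ?F) w"
      using inv[of ?g ?f] F G gf by simp
    then show "?g (?f w) = w" using that by (simp add: compose_def)
  qed
  have "bij_betw ?f (carrier ?F) (carrier ?F)"
    using F G fg' gf' by (intro bij_betw_byWitness[where f' = ?g]) (auto simp: hom_def)
  then show ?thesis using F by (auto simp: carrier_Aut Bij_def)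
qed

section \<open>Evaluation letter by letter, and supports\<close>

lemma Aut_apply_Cons:
  assumes \<phi>: "\<phi> \<in> carrier (Aut n)" and "x # w \<in> carrier (free_group n)"
  shows "\<phi> (x # w) = foldr cancel_cons (\<phi> [x]) (\<phi> w)" "[x] \<in> carrier (free_group n)"
    "w \<in> carrier (free_group n)" "fst x < n"
proof -
  show x: "[x] \<in> carrier (free_group n)" "fst x < n" and w: "w \<in> carrier (free_group n)"
    using assms(2) by (auto simp: carrier_free_group dest: reduced_ConsD)
  have "x # w = foldr cancel_cons [x] w"
    using assms(2) by (auto simp: carrier_free_group cancel_cons_reduced)
  then show "\<phi> (x # w) = foldr cancel_cons (\<phi> [x]) (\<phi> w)"
    using Aut_mult[OF \<phi> x(1) w] by simp
qed

lemma letter_eq_gen: "[x] = gen (fst x) \<or> [x] = word_inv (gen (fst x))"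
  by (cases x) (auto simp: word_inv_def letter_inv_def)

lemma Aut_fixes_word:
  assumes \<phi>: "\<phi> \<in> carrier (Aut n)" and "w \<in> carrier (free_group n)"
    and "\<And>i. i \<in> fst ` set w \<Longrightarrow> \<phi> (gen i) = gen i"
  shows "\<phi> w = w"
  using assms(2,3)
proof (induction w)
  case (Cons x w)
  note * = Aut_apply_Cons[OF \<phi> Cons.prems(1)]
  have "\<phi> [x] = [x]"
    using Cons.prems(2)[of "fst x"] letter_eq_gen[of x] Aut_word_inv[OF \<phi> gen_closed[OF *(4)]] by auto
  then show ?case using * Cons.IH Cons.prems by (simp add: carrier_free_group cancel_cons_reduced)
qed (simp add: Aut_Nil[OF \<phi>])

text \<open>Cancellation only removes letters, so the indices in the image of a word all come from
  the images of its letters. The block argument traces supports with this bound.\<close>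

lemma Aut_support:
  assumes \<phi>: "\<phi> \<in> carrier (Aut n)" and "w \<in> carrier (free_group n)"
    and "\<And>i. i \<in> fst ` set w \<Longrightarrow> fst ` set (\<phi> (gen i)) \<subseteq> T"
  shows "fst ` set (\<phi> w) \<subseteq> T"
  using assms(2,3)
proof (induction w)
  case (Cons x w)
  note * = Aut_apply_Cons[OF \<phi> Cons.prems(1)]
  have "fst ` set (\<phi> [x]) \<subseteq> T"
  proof -
    have T: "fst ` set (\<phi> (gen (fst x))) \<subseteq> T" using Cons.prems(2)[of "fst x"] by simp
    from letter_eq_gen[of x] show ?thesis
    proof
      assume "[x] = gen (fst x)"
      with T show ?thesis by simp
    next
      assume "[x] = word_inv (gen (fst x))"
      then have "\<phi> [x] = word_inv (\<phi> (gen (fst x)))"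
        by (simp only: Aut_word_inv[OF \<phi> gen_closed[OF *(4)]])
      with T show ?thesis by (simp only: fst_set_word_inv)
    qed
  qed
  moreover have "fst ` set (\<phi> w) \<subseteq> T" using Cons.IH[OF *(3)] Cons.prems(2) by auto
  moreover have "fst ` set (\<phi> (x # w)) \<subseteq> fst ` set (\<phi> [x]) \<union> fst ` set (\<phi> w)"
    unfolding *(1) image_Un[symmetric] by (rule image_mono[OF set_foldr_cancel_cons])
  ultimately show ?case by (meson Un_least subset_trans)
qed (simp add: Aut_Nil[OF \<phi>])

subsection \<open>Transvections and inversions\<close>

text \<open>Left transvections suffice, since conjugation by \<open>inversion n i\<close> turns them into right ones.\<close>

definition transvection :: "nat \<Rightarrow> nat \<Rightarrow> nat \<Rightarrow> letter list \<Rightarrow> letter list" where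
  "transvection n i j = free_endo n (\<lambda>k. if k = i then [(j, True), (i, True)] else gen k)"

definition inversion :: "nat \<Rightarrow> nat \<Rightarrow> letter list \<Rightarrow> letter list" where
  "inversion n i = free_endo n (\<lambda>k. if k = i then [(i, False)] else gen k)"

lemma transvection_gen:
  assumes "i < n" "j < n" "k < n" "i \<noteq> j"
  shows "transvection n i j (gen k) = (if k = i then [(j, True), (i, True)] else gen k)"
  unfolding transvection_def using assms
  by (subst free_endo_hom(2)) (auto simp: carrier_free_group letter_inv_def)

lemma inversion_gen:
  assumes "i < n" "k < n"
  shows "inversion n i (gen k) = (if k = i then [(i, False)] else gen k)"
  unfolding inversion_def using assms
  by (subst free_endo_hom(2)) (auto simp: carrier_free_group letter_inv_def)

lemma transvection_closed:
  assumes "i < n" "j < n" "i \<noteq> j"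
  shows "transvection n i j \<in> carrier (Aut n)"
  unfolding transvection_def
  by (rule free_endo_Aut[where g = "\<lambda>k. if k = i then [(j, False), (i, True)] else gen k"];
      (subst free_endo_apply)?)
    (use assms in \<open>auto simp: carrier_free_group letter_inv_def word_inv_def\<close>)

lemma inversion_closed:
  assumes "i < n"
  shows "inversion n i \<in> carrier (Aut n)"
  unfolding inversion_def
  by (rule free_endo_Aut[where g = "\<lambda>k. if k = i then [(i, False)] else gen k"];
      (subst free_endo_apply)?)
    (use assms in \<open>auto simp: carrier_free_group letter_inv_def word_inv_def\<close>)

lemma Aut_apply_letter:
  assumes "\<phi> \<in> carrier (Aut n)" "i < n"
  shows "\<phi> [(i, False)] = word_inv (\<phi> (gen i))"
  using Aut_word_inv[OF assms(1) gen_closed[OF assms(2)]] by (simp add: word_inv_def letter_inv_def)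

lemma Aut_apply_two_letters:
  assumes "\<phi> \<in> carrier (Aut n)" "[x, y] \<in> carrier (free_group n)"
  shows "\<phi> [x, y] = foldr cancel_cons (\<phi> [x]) (\<phi> [y])"
  by (rule Aut_apply_Cons(1)[OF assms])

lemma inversion_square:
  assumes "i < n"
  shows "inversion n i \<otimes>\<^bsub>Aut n\<^esub> inversion n i = \<one>\<^bsub>Aut n\<^esub>"
proof -
  interpret A: group "Aut n" by (rule group_Aut)
  note c = inversion_closed[OF assms]
  show ?thesis
    by (rule Aut_eqI[where n = n])
      (auto simp: c mult_Aut_apply[OF c c] gen_closed one_Aut_apply inversion_gen assms
        Aut_apply_letter[OF c] word_inv_def letter_inv_def)
qed

text \<open>The analogue of the Steinberg relation for elementary matrices: the last transvection is
  a commutator of the other two. Written without inverses, both sides can be evaluated directly on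
  generators.\<close>

lemma transvection_commutator:
  assumes "i < n" "j < n" "k < n" "i \<noteq> j" "j \<noteq> k" "i \<noteq> k"
  shows "transvection n j k \<otimes>\<^bsub>Aut n\<^esub> transvection n i j =
    transvection n i j \<otimes>\<^bsub>Aut n\<^esub> transvection n j k \<otimes>\<^bsub>Aut n\<^esub> transvection n i k"
proof -
  interpret A: group "Aut n" by (rule group_Aut)
  have c: "transvection n j k \<in> carrier (Aut n)" "transvection n i j \<in> carrier (Aut n)"
    "transvection n i k \<in> carrier (Aut n)"
    using assms by (auto intro!: transvection_closed)
  have two: "transvection n a b [x, y] =
      foldr cancel_cons (transvection n a b [x]) (transvection n a b [y])"
    if "a < n" "b < n" "a \<noteq> b" "fst x < n" "fst y < n" "x \<noteq> letter_inv y" for a b x y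
    using that by (intro Aut_apply_two_letters[OF transvection_closed]) (auto simp: carrier_free_group)
  have "[(k, True), (i, True)] \<in> carrier (free_group n)"
    using assms by (simp add: carrier_free_group letter_inv_def)
  then show ?thesis
    using assms by (intro Aut_eqI[where n = n])
      (auto simp: c mult_Aut_apply Aut_closed gen_closed transvection_gen two letter_inv_def)
qed

lemma inv_transvection_gen:
  assumes "i < n" "j < n" "k < n" "i \<noteq> j"
  shows "(inv\<^bsub>Aut n\<^esub> transvection n i j) (gen k) = (if k = i then [(j, False), (i, True)] else gen k)"
proof -
  interpret A: group "Aut n" by (rule group_Aut)
  note c = transvection_closed[OF assms(1,2,4)]
  have w: "(if k = i then [(j, False), (i, True)] else gen k) \<in> carrier (free_group n)" (is "?w \<in> _")
    using assms by (auto simp: carrier_free_group letter_inv_def)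
  have "transvection n i j ?w = gen k"
    using assms w by (auto simp: Aut_apply_two_letters[OF c] transvection_gen Aut_apply_letter[OF c]
        word_inv_def letter_inv_def)
  then show ?thesis using inv_Aut_apply(1)[OF c w] by simp
qed

text \<open>For letters of either sign this is the map \<open>x\<close> to \<open>y x\<close>. If
  \<open>x\<close> is an inverse letter, the underlying generator is multiplied on the right by the
  inverse of \<open>y\<close>, so one notation covers all of Nielsen's moves.\<close>

definition letter_transvection :: "nat \<Rightarrow> letter \<Rightarrow> letter \<Rightarrow> letter list \<Rightarrow> letter list" where
  "letter_transvection n x y =
    (let t = (if snd y then transvection n (fst x) (fst y)
              else inv\<^bsub>Aut n\<^esub> transvection n (fst x) (fst y))
     in if snd x then t else inversion n (fst x) \<otimes>\<^bsub>Aut n\<^esub> t \<otimes>\<^bsub>Aut n\<^esub> inversion n (fst x))"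

lemma letter_transvection_subgroup:
  assumes "subgroup H (Aut n)" "transvection n (fst x) (fst y) \<in> H" "inversion n (fst x) \<in> H"
  shows "letter_transvection n x y \<in> H"
  using assms by (simp add: letter_transvection_def subgroup.m_inv_closed subgroup.m_closed Let_def)

lemma letter_transvection_closed:
  assumes "fst x < n" "fst y < n" "fst x \<noteq> fst y"
  shows "letter_transvection n x y \<in> carrier (Aut n)"
  using assms by (intro letter_transvection_subgroup group.subgroup_self group_Aut
      transvection_closed inversion_closed)

lemma letter_transvection_apply:
  assumes "fst x < n" "fst y < n" "fst x \<noteq> fst y"
  shows "letter_transvection n x y [x] = [y, x]"
    and "\<And>k. k < n \<Longrightarrow> k \<noteq> fst x \<Longrightarrow> letter_transvection n x y (gen k) = gen k"
proof -
  interpret A: group "Aut n" by (rule group_Aut)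
  let ?T = "transvection n (fst x) (fst y)" and ?e = "inversion n (fst x)"
  define t where "t = (if snd y then ?T else inv\<^bsub>Aut n\<^esub> ?T)"
  have t: "t \<in> carrier (Aut n)" using transvection_closed[of "fst x" n "fst y"] assms by (auto simp: t_def)
  note e = inversion_closed[OF assms(1)]
  have tg: "t (gen k) = (if k = fst x then [y, (fst x, True)] else gen k)" if "k < n" for k
    using that assms by (cases y) (auto simp: t_def transvection_gen inv_transvection_gen)
  have w: "[y, (fst x, True)] \<in> carrier (free_group n)"
    using assms by (auto simp: carrier_free_group letter_inv_def)
  have ey: "?e [y] = [y]"
    using assms by - (rule Aut_fixes_word[OF e]; auto simp: inversion_gen carrier_free_group)
  have *: "letter_transvection n x y = (if snd x then t else ?e \<otimes>\<^bsub>Aut n\<^esub> t \<otimes>\<^bsub>Aut n\<^esub> ?e)"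
    by (simp add: letter_transvection_def t_def)
  show "letter_transvection n x y [x] = [y, x]"
  proof (cases "snd x")
    case True
    then show ?thesis using tg[OF assms(1)] * by (cases x) auto
  next
    case False
    then have x: "[x] = [(fst x, False)]" by (cases x) auto
    have "letter_transvection n x y [x] = ?e (t (?e [x]))"
      using False mult_Aut_apply[OF A.m_closed[OF e t] e letter_closed[OF assms(1)]]
        mult_Aut_apply[OF e t Aut_closed[OF e letter_closed[OF assms(1)]]] by (simp add: *)
    also have "?e [x] = gen (fst x)"
      using assms by (simp add: x Aut_apply_letter[OF e] inversion_gen word_inv_def letter_inv_def)
    also have "?e (t (gen (fst x))) = foldr cancel_cons [y] [x]"
      using Aut_apply_two_letters[OF e w] assms ey x by (simp add: tg inversion_gen)
    finally show ?thesis using assms by auto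
  qed
  show "letter_transvection n x y (gen k) = gen k" if "k < n" "k \<noteq> fst x" for k
    using that mult_Aut_apply[OF A.m_closed[OF e t] e gen_closed[OF that(1)]]
      mult_Aut_apply[OF e t gen_closed[OF that(1)]] assms by (simp add: * tg inversion_gen)
qed

text \<open>The matrix with rows (0, 1) and (-1, 0) is a product of three elementary matrices; this
  is the same factorisation for automorphisms. The sign is unavoidable, since transvections have
  determinant 1 on the abelianisation.\<close>

definition signed_swap :: "nat \<Rightarrow> nat \<Rightarrow> nat \<Rightarrow> letter list \<Rightarrow> letter list" where
  "signed_swap n i j = letter_transvection n (i, True) (j, True) \<otimes>\<^bsub>Aut n\<^esub>
     (letter_transvection n (j, True) (i, False) \<otimes>\<^bsub>Aut n\<^esub> letter_transvection n (i, False) (j, False))"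

lemma signed_swap_subgroup:
  assumes "subgroup H (Aut n)" "transvection n i j \<in> H" "transvection n j i \<in> H"
    "inversion n i \<in> H" "inversion n j \<in> H"
  shows "signed_swap n i j \<in> H"
  using assms unfolding signed_swap_def
  by (intro subgroup.m_closed[OF assms(1)] letter_transvection_subgroup) auto

lemma signed_swap_closed:
  assumes "i < n" "j < n" "i \<noteq> j"
  shows "signed_swap n i j \<in> carrier (Aut n)"
  using assms by (intro signed_swap_subgroup group.subgroup_self group_Aut
      transvection_closed inversion_closed) auto

lemma signed_swap_gen:
  assumes "i < n" "j < n" "i \<noteq> j" "k < n"
  shows "signed_swap n i j (gen k) =
    (if k = i then gen j else if k = j then [(i, False)] else gen k)"
proof -
  interpret A: group "Aut n" by (rule group_Aut)
  let ?a = "letter_transvection n (i, True) (j, True)" and ?b = "letter_transvection n (j, True) (i, False)"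
    and ?c = "letter_transvection n (i, False) (j, False)"
  have c: "?a \<in> carrier (Aut n)" "?b \<in> carrier (Aut n)" "?c \<in> carrier (Aut n)"
    using assms by (auto intro!: letter_transvection_closed)
  have w: "\<And>x y. fst x \<noteq> fst y \<Longrightarrow> fst x < n \<Longrightarrow> fst y < n \<Longrightarrow> [x, y] \<in> carrier (free_group n)"
    by (auto simp: carrier_free_group letter_inv_def)
  have g: "?a (gen k) = (if k = i then [(j, True), (i, True)] else gen k)"
    "?b (gen k) = (if k = j then [(i, False), (j, True)] else gen k)"
    if "k < n" for k
    using assms letter_transvection_apply[of "(i, True)" n "(j, True)"]
      letter_transvection_apply[of "(j, True)" n "(i, False)"] that by auto
  have gi: "\<phi> [(l, False)] = word_inv (\<phi> (gen l))" if "l < n" "\<phi> \<in> {?a, ?b}" for l \<phi>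
    using that c Aut_apply_letter[of \<phi> n l] by auto
  have ci: "?c (gen i) = word_inv [(j, False), (i, False)]"
    using Aut_apply_letter[OF c(3) assms(1)] letter_transvection_apply(1)[of "(i, False)" n "(j, False)"] assms
    by (metis fst_conv word_inv_word_inv)
  have ck: "?c (gen k) = gen k" if "k \<noteq> i" "k < n" for k
    using letter_transvection_apply(2)[of "(i, False)" n "(j, False)"] assms that by simp
  have two: "\<phi> [x, y] = foldr cancel_cons (\<phi> [x]) (\<phi> [y])"
    if "\<phi> \<in> {?a, ?b}" "fst x \<noteq> fst y" "fst x < n" "fst y < n" for \<phi> x y
    using Aut_apply_two_letters[of \<phi> n x y] w[of x y] that c by auto
  have "signed_swap n i j (gen k) = ?a (?b (?c (gen k)))"
    using assms c by (simp add: signed_swap_def mult_Aut_apply gen_closed Aut_closed)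
  then show ?thesis
    using assms by (auto simp: ci ck word_inv_def letter_inv_def two g gi)
qed

text \<open>This conjugacy makes the images of all inversions coincide once a homomorphism kills the
  transvections.\<close>

lemma signed_swap_inversion:
  assumes "i < n" "j < n" "i \<noteq> j"
  shows "signed_swap n i j \<otimes>\<^bsub>Aut n\<^esub> inversion n i = inversion n j \<otimes>\<^bsub>Aut n\<^esub> signed_swap n i j"
proof -
  interpret A: group "Aut n" by (rule group_Aut)
  note s = signed_swap_closed[OF assms] and e = inversion_closed[OF assms(1)] inversion_closed[OF assms(2)]
  show ?thesis
    using assms s e by (intro Aut_eqI[where n = n])
      (auto simp: mult_Aut_apply gen_closed signed_swap_gen inversion_gen
        Aut_apply_letter[OF s] Aut_apply_letter[OF e(2)]
        word_inv_def letter_inv_def)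
qed

subsection \<open>Cancellation in products of reduced words\<close>

fun common_prefix_length :: "'a list \<Rightarrow> 'a list \<Rightarrow> nat" where
  "common_prefix_length (x # xs) (y # ys) = (if x = y then Suc (common_prefix_length xs ys) else 0)"
| "common_prefix_length _ _ = 0"

lemma le_common_prefix_length_iff:
  "k \<le> common_prefix_length u v \<longleftrightarrow> k \<le> length u \<and> k \<le> length v \<and> take k u = take k v"
proof (induction u v arbitrary: k rule: common_prefix_length.induct)
  case (1 x xs y ys)
  then show ?case by (cases k) auto
qed auto

lemma common_prefix_length_Nil [simp]: "common_prefix_length u [] = 0"
  by (cases u) simp_all

lemma common_prefix_length_sym: "common_prefix_length u v = common_prefix_length v u"
  by (induction u v rule: common_prefix_length.induct) simp_all

lemma common_prefix_length_le:
  "common_prefix_length u v \<le> length u" "common_prefix_length u v \<le> length v"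
  "take (common_prefix_length u v) u = take (common_prefix_length u v) v"
  using le_common_prefix_length_iff[of "common_prefix_length u v" u v] by auto

text \<open>At the place where \<open>u\<close> leaves \<open>v\<close> or ends, \<open>w\<close>
  still follows \<open>v\<close>; so \<open>u\<close> and \<open>w\<close> part at the same
  place.\<close>

lemma common_prefix_length_ultrametric:
  "common_prefix_length u v < common_prefix_length v w \<Longrightarrow>
   common_prefix_length u w = common_prefix_length u v"
proof (induction u arbitrary: v w)
  case (Cons x u)
  then show ?case by (cases v; cases w) (simp_all split: if_splits)
qed simp

text \<open>In the Cayley tree this is the Gromov product of the inverse of \<open>u\<close> and
  \<open>v\<close>: for reduced words, the number of letters of \<open>u\<close> that vanish against
  equally many of \<open>v\<close> in the product.\<close>

definition cancellation :: "letter list \<Rightarrow> letter list \<Rightarrow> nat" where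
  "cancellation u v = common_prefix_length (word_inv u) v"

lemma reduced_append_cancel:
  assumes "reduced (u @ [x])" "reduced (x # v)"
  shows "foldr cancel_cons u (x # v) = u @ x # v"
  using assms
proof (induction u)
  case (Cons y u)
  then have "foldr cancel_cons u (x # v) = u @ x # v" by (auto dest: reduced_ConsD)
  moreover have "reduced (y # u @ x # v)"
    using Cons.prems unfolding reduced_def
    by (cases u) (auto simp: successively_append_iff successively_Cons hd_append split: if_splits)
  ultimately show ?case by (simp add: cancel_cons_reduced)
qed simp

text \<open>The induction runs from the right end of \<open>u\<close>, because its last letter is
  the first to meet \<open>v\<close>: either it cancels the head of \<open>v\<close> and both words
  shrink, or nothing cancels and the product is the concatenation.\<close>

lemma mult_eq_take_drop:
  assumes "reduced u" "reduced v"
  shows "foldr cancel_cons u v =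
    take (length u - cancellation u v) u @ drop (cancellation u v) v"
  using assms
proof (induction u arbitrary: v rule: rev_induct)
  case Nil
  then show ?case by (cases v) (auto simp: cancellation_def word_inv_def)
next
  case (snoc x u)
  have u: "reduced u" using snoc.prems(1) by (auto simp: reduced_def successively_append_iff)
  show ?case
  proof (cases "\<exists>v'. v = letter_inv x # v'")
    case True
    then obtain v' where v: "v = letter_inv x # v'" by blast
    then have "reduced v'" using snoc.prems(2) by (auto dest: reduced_ConsD)
    from snoc.IH[OF u this] v show ?thesis by (simp add: cancellation_def word_inv_def)
  next
    case False
    then have c: "cancellation (u @ [x]) v = 0" "cancel_cons x v = x # v"
      by (cases v; auto simp: cancellation_def word_inv_def)+
    have "reduced (x # v)" using False snoc.prems(2) by (cases v) auto
    then show ?thesis using reduced_append_cancel[OF snoc.prems(1)] c by simp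
  qed
qed

lemma cancellation_le: "cancellation u v \<le> length u" "cancellation u v \<le> length v"
  using common_prefix_length_le[of "word_inv u" v] by (auto simp: cancellation_def)

lemma length_mult:
  assumes "reduced u" "reduced v"
  shows "length (foldr cancel_cons u v) + 2 * cancellation u v = length u + length v"
  using mult_eq_take_drop[OF assms] cancellation_le[of u v] by simp

text \<open>If half of \<open>u\<close> cancelled against \<open>u\<close>, its letters would mirror
  each other as inverses about the centre. The middle letter of an odd word would then be its own
  inverse, and the two middle letters of an even word would cancel.\<close>

lemma cancellation_self:
  assumes "reduced u" "u \<noteq> []"
  shows "2 * cancellation u u < length u"
proof (rule ccontr)
  assume ge: "\<not> 2 * cancellation u u < length u"
  define c where "c = cancellation u u"
  have h: "(length u + 1) div 2 \<le> c" and c: "c \<le> length u"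
    using ge cancellation_le[of u u] by (auto simp: c_def)
  have "u ! k = letter_inv (u ! (length u - 1 - k))" if "k < c" for k
  proof -
    have "take c (word_inv u) ! k = take c u ! k"
      using common_prefix_length_le(3)[of "word_inv u" u] by (simp add: c_def cancellation_def)
    then show ?thesis using that c by (simp add: word_inv_def rev_nth)
  qed
  note * = this
  show False
  proof (cases "even (length u)")
    case False
    then have "length u - 1 - length u div 2 = length u div 2" "length u div 2 < c"
      using h by presburger+
    then show False using *[of "length u div 2"] by simp
  next
    case True
    then obtain m where m: "length u = 2 * m" by (rule evenE)
    define k where "k = m - 1"
    have "m > 0" using m assms(2) by (cases m) auto
    then have k: "length u - 1 - k = Suc k" "k < c" "Suc k < length u"
      using m h by (auto simp: k_def)
    have "u ! k = letter_inv (u ! Suc k)" using *[of k] k by simp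
    moreover have "u ! Suc k \<noteq> letter_inv (u ! k)"
      using assms(1) k(3) by (simp add: reduced_def successively_conv_nth)
    ultimately show False by simp
  qed
qed

lemma cancellation_word_inv: "cancellation (word_inv v) (word_inv u) = cancellation u v"
  by (simp add: cancellation_def common_prefix_length_sym)

lemma take_mult_eq:
  assumes "reduced u" "reduced v" "k \<le> length u - cancellation u v"
  shows "take k (foldr cancel_cons u v) = take k u"
  using assms mult_eq_take_drop[OF assms(1,2)] by simp

subsection \<open>Nielsen's theorem\<close>

text \<open>Nielsen's conditions on the basis formed by the images of the generators. Letters carry
  both signs, so inverses are included, and cancellation numbers replace the usual inequalities
  between lengths of products.\<close>

definition nielsen_reduced :: "nat \<Rightarrow> (letter list \<Rightarrow> letter list) \<Rightarrow> bool" where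
  "nielsen_reduced n \<phi> \<longleftrightarrow>
    (\<forall>x y. fst x < n \<longrightarrow> fst y < n \<longrightarrow> y \<noteq> letter_inv x \<longrightarrow>
       2 * cancellation (\<phi> [x]) (\<phi> [y]) \<le> length (\<phi> [x]) \<and>
       2 * cancellation (\<phi> [x]) (\<phi> [y]) \<le> length (\<phi> [y])) \<and>
    (\<forall>x y z. fst x < n \<longrightarrow> fst y < n \<longrightarrow> fst z < n \<longrightarrow> y \<noteq> letter_inv x \<longrightarrow> z \<noteq> letter_inv y \<longrightarrow>
       cancellation (\<phi> [x]) (\<phi> [y]) + cancellation (\<phi> [y]) (\<phi> [z]) < length (\<phi> [y]))"

lemma nielsen_reduced_pairD:
  assumes "nielsen_reduced n \<phi>" "fst x < n" "fst y < n" "y \<noteq> letter_inv x"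
  shows "2 * cancellation (\<phi> [x]) (\<phi> [y]) \<le> length (\<phi> [x])"
    "2 * cancellation (\<phi> [x]) (\<phi> [y]) \<le> length (\<phi> [y])"
  using assms unfolding nielsen_reduced_def by blast+

lemma nielsen_reduced_tripleD:
  assumes "nielsen_reduced n \<phi>" "fst x < n" "fst y < n" "fst z < n"
    "y \<noteq> letter_inv x" "z \<noteq> letter_inv y"
  shows "cancellation (\<phi> [x]) (\<phi> [y]) + cancellation (\<phi> [y]) (\<phi> [z]) < length (\<phi> [y])"
  using assms unfolding nielsen_reduced_def by blast

lemma Aut_letter_nonempty:
  assumes "\<phi> \<in> carrier (Aut n)" "fst x < n"
  shows "\<phi> [x] \<noteq> []"
proof
  assume "\<phi> [x] = []"
  then have "\<phi> [x] = \<phi> []" by (simp add: Aut_Nil[OF assms(1)])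
  then show False
    using inj_onD[OF Aut_inj[OF assms(1)], of "[x]" "[]"] assms(2) by (simp add: carrier_free_group)
qed

text \<open>The initial part of the image of the first letter that survives in the image of the word
  is longer than any cancellation on its left; this makes the induction work.\<close>

lemma nielsen_reduced_length:
  assumes \<phi>: "\<phi> \<in> carrier (Aut n)" and red: "nielsen_reduced n \<phi>"
    and "y # w \<in> carrier (free_group n)"
  defines "c \<equiv> \<lambda>w. case w of [] \<Rightarrow> 0 | z # _ \<Rightarrow> cancellation (\<phi> [y]) (\<phi> [z])"
  shows "length (\<phi> (y # w)) \<ge> length (\<phi> [y]) - c w + length w \<and>
    take (length (\<phi> [y]) - c w) (\<phi> (y # w)) = take (length (\<phi> [y]) - c w) (\<phi> [y])"
  using assms(3) unfolding c_def
proof (induction w arbitrary: y)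
  case Nil
  then show ?case by simp
next
  case (Cons z w)
  let ?c = "cancellation (\<phi> [y]) (\<phi> [z])"
  let ?d = "case w of [] \<Rightarrow> 0 | z' # _ \<Rightarrow> cancellation (\<phi> [z]) (\<phi> [z'])"
  note y = Aut_apply_Cons[OF \<phi> Cons.prems] and z = Aut_apply_Cons[OF \<phi> Aut_apply_Cons(3)[OF \<phi> Cons.prems]]
  have zy: "z \<noteq> letter_inv y" using Cons.prems by (simp add: carrier_free_group)
  have IH: "length (\<phi> (z # w)) \<ge> length (\<phi> [z]) - ?d + length w"
    "take (length (\<phi> [z]) - ?d) (\<phi> (z # w)) = take (length (\<phi> [z]) - ?d) (\<phi> [z])"
    using Cons.IH[OF y(3)] by auto
  have red_y: "reduced (\<phi> [y])" and red_w: "reduced (\<phi> (z # w))"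
    using Aut_closed[OF \<phi> y(2)] Aut_closed[OF \<phi> y(3)] by (auto simp: carrier_free_group)
  \<comment> \<open>Some letter of \<open>\<phi> [z]\<close> survives the cancellation on both
    sides: by the triple condition if a letter follows \<open>z\<close>, and by the pair condition
    and nonemptiness of the image if \<open>z\<close> is the last letter.\<close>
  have cd: "?c + ?d < length (\<phi> [z])"
  proof (cases w)
    case Nil
    have "2 * ?c \<le> length (\<phi> [z])" "length (\<phi> [z]) > 0"
      using nielsen_reduced_pairD[OF red y(4) z(4) zy] Aut_letter_nonempty[OF \<phi> z(4)] by auto
    then have "?c < length (\<phi> [z])" by linarith
    then show ?thesis using Nil by simp
  next
    case (Cons z' w')
    have "fst z' < n" "z' \<noteq> letter_inv z"
      using \<open>y # z # w \<in> _\<close> Cons by (auto simp: carrier_free_group)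
    then show ?thesis using nielsen_reduced_tripleD[OF red y(4) z(4) _ zy] Cons by simp
  qed
  \<comment> \<open>The words \<open>\<phi> (z # w)\<close> and \<open>\<phi> [z]\<close> share a
    prefix longer than the cancellation with \<open>\<phi> [y]\<close>, so by the ultrametric rule
    the tail \<open>w\<close> has no influence on that cancellation.\<close>
  have "length (\<phi> [z]) - ?d \<le> common_prefix_length (\<phi> [z]) (\<phi> (z # w))"
    using IH by (simp add: le_common_prefix_length_iff)
  with cd have c: "cancellation (\<phi> [y]) (\<phi> (z # w)) = ?c"
    unfolding cancellation_def by (intro common_prefix_length_ultrametric) (simp add: cancellation_def)
  have len: "length (\<phi> (y # z # w)) + 2 * ?c = length (\<phi> [y]) + length (\<phi> (z # w))"
    using length_mult[OF red_y red_w] c y(1) by simp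
  have "take (length (\<phi> [y]) - ?c) (\<phi> (y # z # w)) = take (length (\<phi> [y]) - ?c) (\<phi> [y])"
    using take_mult_eq[OF red_y red_w] c y(1) by simp
  moreover have "length (\<phi> (y # z # w)) \<ge> length (\<phi> [y]) - ?c + length (z # w)"
    using len IH(1) cd cancellation_le[of "\<phi> [y]" "\<phi> [z]"] by simp
  ultimately show ?case by simp
qed

lemma nielsen_reduced_length_le:
  assumes \<phi>: "\<phi> \<in> carrier (Aut n)" and red: "nielsen_reduced n \<phi>"
    and w: "w \<in> carrier (free_group n)"
  shows "length w \<le> length (\<phi> w)"
proof (cases w)
  case (Cons y v)
  let ?c = "case v of [] \<Rightarrow> 0 | z # _ \<Rightarrow> cancellation (\<phi> [y]) (\<phi> [z])"
  have "?c < length (\<phi> [y])"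
  proof (cases v)
    case Nil
    then show ?thesis using Aut_letter_nonempty[OF \<phi>, of y] Cons w by (simp add: carrier_free_group)
  next
    case (Cons z v')
    have yz: "fst y < n" "fst z < n" "z \<noteq> letter_inv y"
      using w \<open>w = y # v\<close> Cons by (auto simp: carrier_free_group)
    then have "2 * ?c \<le> length (\<phi> [y])"
      using nielsen_reduced_pairD[OF red yz] Cons by simp
    moreover have "length (\<phi> [y]) > 0" using Aut_letter_nonempty[OF \<phi> yz(1)] by simp
    ultimately show ?thesis by linarith
  qed
  moreover have "length (\<phi> (y # v)) \<ge> length (\<phi> [y]) - ?c + length v"
    using nielsen_reduced_length[OF \<phi> red, of y v] w Cons by simp
  ultimately have "length (\<phi> (y # v)) \<ge> Suc (length v)" by linarith
  then show ?thesis using Cons by simp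
qed simp

text \<open>Nielsen reduced automorphisms never shorten a word, so the preimage of a generator is a
  single letter: the inverse permutes the generators up to sign.\<close>

lemma nielsen_reduced_inv_gen:
  assumes \<phi>: "\<phi> \<in> carrier (Aut n)" and red: "nielsen_reduced n \<phi>" and "i < n"
  shows "\<exists>x. fst x < n \<and> (inv\<^bsub>Aut n\<^esub> \<phi>) (gen i) = [x]"
proof -
  interpret A: group "Aut n" by (rule group_Aut)
  let ?w = "(inv\<^bsub>Aut n\<^esub> \<phi>) (gen i)"
  have w: "?w \<in> carrier (free_group n)" using Aut_closed[OF A.inv_closed[OF \<phi>] gen_closed] assms(3) by simp
  have "length ?w \<le> 1"
    using nielsen_reduced_length_le[OF \<phi> red w] inv_Aut_apply(2)[OF \<phi> gen_closed] assms(3) by simp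
  moreover have "?w \<noteq> []" using Aut_letter_nonempty[OF A.inv_closed[OF \<phi>]] assms(3) by simp
  ultimately show ?thesis using w by (cases ?w) (auto simp: carrier_free_group)
qed

section \<open>Signed permutations of the generators\<close>

lemma signed_diagonal_generation:
  assumes H: "subgroup H (Aut n)" and inv: "\<And>i. i < n \<Longrightarrow> inversion n i \<in> H"
    and "\<phi> \<in> carrier (Aut n)" "\<And>i. i < n \<Longrightarrow> \<phi> (gen i) = gen i \<or> \<phi> (gen i) = [(i, False)]"
  shows "\<phi> \<in> H"
  using assms(3,4)
proof (induction "card {i. i < n \<and> \<phi> (gen i) \<noteq> gen i}" arbitrary: \<phi> rule: less_induct)
  case less
  interpret A: group "Aut n" by (rule group_Aut)
  let ?S = "\<lambda>\<phi>. {i. i < n \<and> \<phi> (gen i) \<noteq> gen i}"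
  show ?case
  proof (cases "?S \<phi> = {}")
    case True
    then have "\<phi> = \<one>\<^bsub>Aut n\<^esub>"
      using less.prems by (intro Aut_eqI[where n = n]) (auto simp: one_Aut_apply gen_closed)
    then show ?thesis using subgroup.one_closed[OF H] by simp
  next
    case False
    then obtain i where i: "i < n" "\<phi> (gen i) = [(i, False)]" using less.prems(2) by auto
    note e = inversion_closed[OF i(1)]
    \<comment> \<open>Composing with this inversion repairs \<open>i\<close> and changes no other
      generator, because the images of the others do not involve \<open>i\<close>.\<close>
    let ?\<psi> = "inversion n i \<otimes>\<^bsub>Aut n\<^esub> \<phi>"
    have \<psi>: "?\<psi> (gen k) = (if k = i then gen i else \<phi> (gen k))" if "k < n" for k
      using that i less.prems(2)[of k]
      by (auto simp: mult_Aut_apply[OF e less.prems(1)] gen_closed inversion_gen Aut_apply_letter[OF e]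
          word_inv_def letter_inv_def)
    have "k \<in> ?S \<phi> - {i}" if "k \<in> ?S ?\<psi>" for k
      using \<psi>[of k] that by (cases "k = i") auto
    then have "?S ?\<psi> \<subset> ?S \<phi>" using i by fastforce
    then have "card (?S ?\<psi>) < card (?S \<phi>)" by (intro psubset_card_mono) auto
    then have "?\<psi> \<in> H"
      using less.hyps[of ?\<psi>] less.prems \<psi> e A.m_closed by (metis (no_types, lifting))
    then have "inversion n i \<otimes>\<^bsub>Aut n\<^esub> ?\<psi> \<in> H" using inv[OF i(1)] subgroup.m_closed[OF H] by blast
    then show ?thesis
      using inversion_square[OF i(1)] e less.prems(1) by (simp add: A.m_assoc[symmetric])
  qed
qed

text \<open>A signed swap puts one more generator into its place and displaces none that is already
  there, so the number of misplaced generators decreases. When it is zero, only signs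
  remain.\<close>

lemma signed_permutation_generation:
  assumes H: "subgroup H (Aut n)" and inv: "\<And>i. i < n \<Longrightarrow> inversion n i \<in> H"
    and tr: "\<And>i j. i < n \<Longrightarrow> j < n \<Longrightarrow> i \<noteq> j \<Longrightarrow> transvection n i j \<in> H"
    and "\<phi> \<in> carrier (Aut n)" "\<And>i. i < n \<Longrightarrow> \<exists>x. fst x < n \<and> \<phi> (gen i) = [x]"
  shows "\<phi> \<in> H"
  using assms(4,5)
proof (induction "card {i. i < n \<and> fst (hd (\<phi> (gen i))) \<noteq> i}" arbitrary: \<phi> rule: less_induct)
  case less
  interpret A: group "Aut n" by (rule group_Aut)
  let ?S = "\<lambda>\<phi>. {i. i < n \<and> fst (hd (\<phi> (gen i))) \<noteq> i}"
  show ?case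
  proof (cases "?S \<phi> = {}")
    case True
    have "\<phi> (gen i) = gen i \<or> \<phi> (gen i) = [(i, False)]" if i: "i < n" for i
    proof -
      obtain x where "\<phi> (gen i) = [x]" using less.prems(2)[OF i] by blast
      moreover from this have "fst x = i" using True i by auto
      ultimately show ?thesis by (cases x) auto
    qed
    then show ?thesis by (intro signed_diagonal_generation[OF H inv less.prems(1)])
  next
    case False
    then obtain i where i: "i < n" "fst (hd (\<phi> (gen i))) \<noteq> i" by auto
    obtain x where x: "\<phi> (gen i) = [x]" "fst x < n" using less.prems(2)[OF i(1)] by blast
    define j where "j = fst x"
    have j: "j < n" "i \<noteq> j" using x i by (auto simp: j_def)
    let ?s = "signed_swap n i j"
    let ?\<psi> = "?s \<otimes>\<^bsub>Aut n\<^esub> \<phi>"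
    note s = signed_swap_closed[OF i(1) j]
    have sl: "\<exists>z. ?s [y] = [z] \<and> fst z = (if fst y = i then j else if fst y = j then i else fst y)"
      if "fst y < n" for y
      using signed_swap_gen[OF i(1) j that] Aut_apply_letter[OF s that]
      by (cases y; cases "snd y") (auto simp: word_inv_def letter_inv_def)
    have \<psi>: "\<exists>z. fst z < n \<and> ?\<psi> (gen k) = [z] \<and>
      fst z = (let m = fst (hd (\<phi> (gen k))) in if m = i then j else if m = j then i else m)" if k: "k < n" for k
    proof -
      obtain y where y: "\<phi> (gen k) = [y]" "fst y < n" using less.prems(2)[OF k] by blast
      then show ?thesis using sl[OF y(2)] mult_Aut_apply[OF s less.prems(1) gen_closed[OF k]] i(1) j
        by (auto simp: Let_def)
    qed
    \<comment> \<open>Place \<open>j\<close> is occupied by the image of generator \<open>i\<close>,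
      and injectivity keeps generator \<open>j\<close> from being there too. Hence the swap, which
      moves what sits at \<open>i\<close> and \<open>j\<close>, spoils no correct position.\<close>
    have "fst (hd (\<phi> (gen j))) \<noteq> j"
    proof
      assume a: "fst (hd (\<phi> (gen j))) = j"
      obtain y where y: "\<phi> (gen j) = [y]" using less.prems(2)[OF j(1)] by blast
      have "\<phi> (gen i) = \<phi> (gen j) \<or> \<phi> (gen i) = word_inv (\<phi> (gen j))"
        using a x y by (cases x; cases y) (auto simp: j_def word_inv_def letter_inv_def)
      then have "\<phi> (gen i) = \<phi> (gen j) \<or> \<phi> (gen i) = \<phi> [(j, False)]"
        using Aut_apply_letter[OF less.prems(1) j(1)] by simp
      then show False
        using inj_onD[OF Aut_inj[OF less.prems(1)], of "gen i" "gen j"]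
          inj_onD[OF Aut_inj[OF less.prems(1)], of "gen i" "[(j, False)]"] i j
        by (auto simp: carrier_free_group)
    qed
    then have "k \<in> ?S \<phi> - {i}" if k: "k \<in> ?S ?\<psi>" for k
      using \<psi>[of k] x i k by (cases "k = i"; cases "k = j") (auto simp: Let_def j_def split: if_splits)
    then have "?S ?\<psi> \<subset> ?S \<phi>" using i by blast
    then have "card (?S ?\<psi>) < card (?S \<phi>)" by (intro psubset_card_mono) auto
    moreover have "?\<psi> \<in> carrier (Aut n)" using s less.prems(1) by simp
    moreover have "\<And>k. k < n \<Longrightarrow> \<exists>z. fst z < n \<and> ?\<psi> (gen k) = [z]" using \<psi> by blast
    ultimately have "?\<psi> \<in> H" by (rule less.hyps)
    moreover have "?s \<in> H" using i j by (intro signed_swap_subgroup[OF H] inv tr) auto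
    ultimately have "inv\<^bsub>Aut n\<^esub> ?s \<otimes>\<^bsub>Aut n\<^esub> ?\<psi> \<in> H"
      using subgroup.m_closed[OF H] subgroup.m_inv_closed[OF H] by blast
    then show ?thesis using s less.prems(1) by (simp add: A.m_assoc[symmetric])
  qed
qed

text \<open>Reading words as numerals in base \<open>2 n\<close> turns the lexicographic comparison of words of
  equal length into a comparison of numbers that can be summed over the generators.\<close>

definition word_code :: "nat \<Rightarrow> letter list \<Rightarrow> nat" where
  "word_code n w = horner_sum (\<lambda>x. 2 * fst x + of_bool (snd x)) (2 * n) (rev w)"

lemma word_code_append:
  "word_code n (u @ v) = word_code n v + (2 * n) ^ length v * word_code n u"
  by (simp add: word_code_def horner_sum_append)

text \<open>Uniqueness of numerals in base \<open>2 * n\<close>, by comparing last digits. The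
  lengths have to agree because \<open>(0, False)\<close> has digit 0 and leading zeros are
  invisible.\<close>

lemma word_code_inj:
  assumes "word_code n u = word_code n v" "length u = length v"
    "fst ` set u \<subseteq> {..<n}" "fst ` set v \<subseteq> {..<n}"
  shows "u = v"
  using assms
proof (induction u arbitrary: v rule: rev_induct)
  case (snoc x u)
  then obtain y v' where v: "v = v' @ [y]" by (cases v rule: rev_cases) auto
  let ?d = "\<lambda>x::letter. 2 * fst x + of_bool (snd x)"
  have d: "?d x < 2 * n" "?d y < 2 * n" using snoc.prems(3,4) v by auto
  have eq: "?d x + 2 * n * word_code n u = ?d y + 2 * n * word_code n v'"
    using snoc.prems(1) v by (simp add: word_code_def)
  then have "(?d x + 2 * n * word_code n u) mod (2 * n) = (?d y + 2 * n * word_code n v') mod (2 * n)"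
    by (rule arg_cong)
  then have xy: "?d x = ?d y" using d by (simp only: mod_mult_self2 mod_less)
  then have "x = y" by (cases x; cases y) (auto simp: of_bool_def split: if_splits; presburger)
  moreover have "word_code n u = word_code n v'" using eq xy d by simp
  ultimately show ?case using snoc.IH[of v'] snoc.prems v by auto
qed simp

text \<open>Nielsen's tie-breaker between words of equal length. Reading the initial halves of both
  \<open>w\<close> and its inverse gives a word and its inverse the same value; halves are rounded
  down, so an odd word omits its middle letter.\<close>

definition half_code :: "nat \<Rightarrow> letter list \<Rightarrow> nat" where
  "half_code n w = word_code n (take (length w div 2) w) +
     word_code n (take (length w div 2) (word_inv w))"

lemma half_code_word_inv: "half_code n (word_inv w) = half_code n w"
  by (simp add: half_code_def)

text \<open>Only the generator underlying \<open>y\<close> gets a new image, and \<open>m\<close>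
  does not see the sign of \<open>y\<close>; so a single summand changes. The terms are arranged as
  sums to avoid truncated subtraction.\<close>

lemma letter_transvection_step:
  assumes \<phi>: "\<phi> \<in> carrier (Aut n)" and xy: "fst x < n" "fst y < n" "fst y \<noteq> fst x"
  defines "\<psi> \<equiv> \<phi> \<otimes>\<^bsub>Aut n\<^esub> letter_transvection n y x"
  shows "\<psi> \<in> carrier (Aut n)"
    and "\<And>m :: letter list \<Rightarrow> nat. (\<And>w. m (word_inv w) = m w) \<Longrightarrow>
      (\<Sum>k<n. m (\<psi> (gen k))) + m (\<phi> [y]) =
      (\<Sum>k<n. m (\<phi> (gen k))) + m (foldr cancel_cons (\<phi> [x]) (\<phi> [y]))"
proof -
  interpret A: group "Aut n" by (rule group_Aut)
  note t = letter_transvection_closed[OF xy(2,1,3)] and ta = letter_transvection_apply[OF xy(2,1,3)]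
  show \<psi>: "\<psi> \<in> carrier (Aut n)" using \<phi> t by (simp add: \<psi>_def)
  have w: "[x, y] \<in> carrier (free_group n)" using xy by (auto simp: carrier_free_group)
  have \<psi>y: "\<psi> [y] = foldr cancel_cons (\<phi> [x]) (\<phi> [y])"
    using mult_Aut_apply[OF \<phi> t letter_closed[OF xy(2)]] ta(1) Aut_apply_two_letters[OF \<phi> w]
    by (simp add: \<psi>_def)
  have \<psi>k: "\<psi> (gen k) = \<phi> (gen k)" if "k < n" "k \<noteq> fst y" for k
    using mult_Aut_apply[OF \<phi> t gen_closed[OF that(1)]] ta(2)[OF that] by (simp add: \<psi>_def)
  fix m :: "letter list \<Rightarrow> nat" assume m: "\<And>w. m (word_inv w) = m w"
  have my: "m (\<theta> [y]) = m (\<theta> (gen (fst y)))" if "\<theta> \<in> carrier (Aut n)" for \<theta>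
    using Aut_apply_letter[OF that xy(2)] m by (cases y; cases "snd y") auto
  have split: "(\<Sum>k<n. m (\<theta> (gen k))) = m (\<theta> (gen (fst y))) + (\<Sum>k\<in>{..<n} - {fst y}. m (\<theta> (gen k)))" for \<theta>
    using xy(2) by (intro sum.remove) auto
  have "(\<Sum>k\<in>{..<n} - {fst y}. m (\<psi> (gen k))) = (\<Sum>k\<in>{..<n} - {fst y}. m (\<phi> (gen k)))"
    by (rule sum.cong) (auto simp: \<psi>k)
  then show "(\<Sum>k<n. m (\<psi> (gen k))) + m (\<phi> [y]) =
      (\<Sum>k<n. m (\<phi> (gen k))) + m (foldr cancel_cons (\<phi> [x]) (\<phi> [y]))"
    using split[of \<phi>] split[of \<psi>] my[OF \<phi>] my[OF \<psi>] \<psi>y by simp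
qed

text \<open>The second half of \<open>v\<close> cancels the first \<open>h\<close> letters of
  \<open>w\<close>, so the product replaces them by the first half of \<open>v\<close>: the same
  length, but smaller leading digits. The far end of \<open>w\<close>, which the other summand of
  the code reads, is untouched.\<close>

lemma half_code_decrease:
  assumes v: "reduced v" "length v = 2 * h" and w: "reduced w" "2 * h \<le> length w"
    and c: "cancellation v w = h"
    and less: "word_code n (take h v) < word_code n (take h (word_inv v))" and "n > 0"
  shows "length (foldr cancel_cons v w) = length w"
    and "half_code n (foldr cancel_cons v w) < half_code n w"
proof -
  let ?l = "length w div 2"
  let ?r = "take (?l - h) (drop h w)"
  show len: "length (foldr cancel_cons v w) = length w"
    using length_mult[OF v(1) w(1)] c v(2) by simp
  have vw: "foldr cancel_cons v w = take h v @ drop h w"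
    using mult_eq_take_drop[OF v(1) w(1)] c v(2) by simp
  have q: "take h (word_inv v) = take h w"
    using common_prefix_length_le(3)[of "word_inv v" w] c by (simp add: cancellation_def)
  have l: "h \<le> ?l" "?l \<le> length w - h" using w(2) by auto
  have 1: "take ?l (foldr cancel_cons v w) = take h v @ ?r"
    using vw l v(2) by simp
  have 2: "take ?l w = take h (word_inv v) @ ?r"
    using q l by (metis append_take_drop_id le_add_diff_inverse take_add)
  \<comment> \<open>At most \<open>length w - h\<close> final letters are read here, so what stands
    before \<open>drop h w\<close> does not matter.\<close>
  have inv: "take ?l (word_inv (u @ drop h w)) = take ?l (word_inv (drop h w))" for u
    using l by (simp add: word_inv_def)
  have 3: "take ?l (word_inv (foldr cancel_cons v w)) = take ?l (word_inv w)"
    using inv[of "take h v"] inv[of "take h w"] vw by simp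
  have "word_code n (take h v @ ?r) < word_code n (take h (word_inv v) @ ?r)"
    using less \<open>n > 0\<close> by (simp add: word_code_append)
  then show "half_code n (foldr cancel_cons v w) < half_code n w"
    unfolding half_code_def len 1 2 3 by simp
qed

text \<open>If a product of two images cancels too much, a transvection lowers the total length.
  Otherwise a triple fails, its middle image being consumed exactly up to the centre from both
  sides; a transvection then keeps the length, and the two unequal halves let the code drop.\<close>

lemma nielsen_step:
  assumes \<phi>: "\<phi> \<in> carrier (Aut n)" and not_red: "\<not> nielsen_reduced n \<phi>"
  defines "L \<equiv> \<lambda>\<phi>. \<Sum>k<n. length (\<phi> (gen k))" and "M \<equiv> \<lambda>\<phi>. \<Sum>k<n. half_code n (\<phi> (gen k))"
  shows "\<exists>x y. fst x < n \<and> fst y < n \<and> fst y \<noteq> fst x \<and>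
    (let \<psi> = \<phi> \<otimes>\<^bsub>Aut n\<^esub> letter_transvection n y x in L \<psi> < L \<phi> \<or> L \<psi> = L \<phi> \<and> M \<psi> < M \<phi>)"
proof -
  have red: "reduced (\<phi> [x])" if "fst x < n" for x
    using Aut_closed[OF \<phi> letter_closed[OF that]] by (simp add: carrier_free_group)
  have inv: "\<phi> [letter_inv x] = word_inv (\<phi> [x])" if "fst x < n" for x
    using Aut_word_inv[OF \<phi> letter_closed[OF that]] by (simp add: word_inv_def)
  have self: "2 * cancellation (\<phi> [x]) (\<phi> [x]) < length (\<phi> [x])" if "fst x < n" for x
    by (rule cancellation_self[OF red[OF that] Aut_letter_nonempty[OF \<phi> that]])
  have Lm: "L (\<phi> \<otimes>\<^bsub>Aut n\<^esub> letter_transvection n y x) + length (\<phi> [y]) =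
      L \<phi> + length (foldr cancel_cons (\<phi> [x]) (\<phi> [y]))" 
    "M (\<phi> \<otimes>\<^bsub>Aut n\<^esub> letter_transvection n y x) + half_code n (\<phi> [y]) =
      M \<phi> + half_code n (foldr cancel_cons (\<phi> [x]) (\<phi> [y]))" 
    if "fst x < n" "fst y < n" "fst y \<noteq> fst x" for x y
    using letter_transvection_step(2)[OF \<phi> that, of length]
      letter_transvection_step(2)[OF \<phi> that, of "half_code n"]
    by (simp_all add: L_def M_def half_code_word_inv)
  show ?thesis
  proof (cases "\<exists>x y. fst x < n \<and> fst y < n \<and> y \<noteq> letter_inv x \<and>
      2 * cancellation (\<phi> [x]) (\<phi> [y]) > length (\<phi> [x])")
    case True
    then obtain x y where xy: "fst x < n" "fst y < n" "y \<noteq> letter_inv x"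
      "2 * cancellation (\<phi> [x]) (\<phi> [y]) > length (\<phi> [x])" by blast
    have "y \<noteq> x" using xy(4) self[OF xy(1)] by auto
    then have ne: "fst y \<noteq> fst x" using xy(3) by (cases x; cases y) (auto simp: letter_inv_def)
    have "L (\<phi> \<otimes>\<^bsub>Aut n\<^esub> letter_transvection n y x) < L \<phi>"
      using Lm(1)[OF xy(1,2) ne] length_mult[OF red red, OF xy(1,2)] xy(4) by linarith
    then show ?thesis using xy ne by (intro exI[of _ x] exI[of _ y]) (simp add: Let_def)
  next
    case False
    have pair1: "2 * cancellation (\<phi> [x]) (\<phi> [y]) \<le> length (\<phi> [x])"
      if "fst x < n" "fst y < n" "y \<noteq> letter_inv x" for x y
      using False that by (meson not_less)
    have pair2: "2 * cancellation (\<phi> [x]) (\<phi> [y]) \<le> length (\<phi> [y])"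
      if "fst x < n" "fst y < n" "y \<noteq> letter_inv x" for x y
    proof -
      have "letter_inv x \<noteq> letter_inv (letter_inv y)" using that(3) by (metis letter_inv_simps(1))
      then show ?thesis using pair1[of "letter_inv y" "letter_inv x"] that
        by (simp add: inv cancellation_word_inv)
    qed
    obtain x y z where xyz: "fst x < n" "fst y < n" "fst z < n" "y \<noteq> letter_inv x" "z \<noteq> letter_inv y"
      "\<not> cancellation (\<phi> [x]) (\<phi> [y]) + cancellation (\<phi> [y]) (\<phi> [z]) < length (\<phi> [y])"
      using not_red pair1 pair2 unfolding nielsen_reduced_def by metis
    \<comment> \<open>By the pair conditions each neighbour takes at most half of
      \<open>\<phi> [y]\<close>; together they take all of it, so each takes exactly half.\<close>
    define h where "h = cancellation (\<phi> [y]) (\<phi> [z])"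
    have h: "length (\<phi> [y]) = 2 * h" "cancellation (\<phi> [x]) (\<phi> [y]) = h"
      using pair1[OF xyz(2,3,5)] pair2[OF xyz(1,2,4)] xyz(6) by (auto simp: h_def)
    have step: ?thesis
      if ab: "fst a < n" "fst b < n" "b \<noteq> letter_inv a" "length (\<phi> [a]) = 2 * h"
        "cancellation (\<phi> [a]) (\<phi> [b]) = h"
        "word_code n (take h (\<phi> [a])) < word_code n (take h (word_inv (\<phi> [a])))" for a b
    proof -
      have "b \<noteq> a" using ab(4,5) self[OF ab(1)] by auto
      then have ne: "fst b \<noteq> fst a" using ab(3) by (cases a; cases b) (auto simp: letter_inv_def)
      have "2 * h \<le> length (\<phi> [b])" using pair2[OF ab(1-3)] ab(5) by simp
      note d = half_code_decrease[OF red[OF ab(1)] ab(4) red[OF ab(2)] this ab(5,6)]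
      show ?thesis
        using Lm[OF ab(1,2) ne] d ab ne
        by (intro exI[of _ a] exI[of _ b]) (auto simp: Let_def)
    qed
    let ?v = "\<phi> [y]"
    \<comment> \<open>Equality would make \<open>\<phi> [y]\<close> cancel half of its length
      against itself.\<close>
    have "take h ?v \<noteq> take h (word_inv ?v)"
    proof
      assume "take h ?v = take h (word_inv ?v)"
      then have "h \<le> cancellation ?v ?v"
        unfolding cancellation_def using h(1) by (simp add: le_common_prefix_length_iff)
      then show False using self[OF xyz(2)] h(1) by simp
    qed
    moreover have "fst ` set (take h w) \<subseteq> {..<n}" if "w \<in> carrier (free_group n)" for w
      using that set_take_subset[of h w] by (auto simp: carrier_free_group)
    then have "fst ` set (take h ?v) \<subseteq> {..<n}" "fst ` set (take h (word_inv ?v)) \<subseteq> {..<n}"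
      using Aut_closed[OF \<phi> letter_closed[OF xyz(2)]] word_inv_closed by blast+
    ultimately have "word_code n (take h ?v) \<noteq> word_code n (take h (word_inv ?v))"
      using word_code_inj[of n "take h ?v" "take h (word_inv ?v)"] by auto
    then consider "word_code n (take h ?v) < word_code n (take h (word_inv ?v))"
      | "word_code n (take h (word_inv ?v)) < word_code n (take h ?v)" by linarith
    then show ?thesis
    proof cases
      case 1
      then show ?thesis using step[OF xyz(2,3,5) h(1)] by (simp add: h_def)
    next
      case 2
      \<comment> \<open>The mirrored triple: the inverse of \<open>y\<close> now multiplies the
        inverse of \<open>x\<close>, and the two halves exchange their roles.\<close>
      have "letter_inv x \<noteq> letter_inv (letter_inv y)" using xyz(4) by (metis letter_inv_simps(1))
      then show ?thesis using step[of "letter_inv y" "letter_inv x"] 2 xyz h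
        by (simp add: inv cancellation_word_inv)
    qed
  qed
qed

text \<open>Composing with transvections of letters lowers the pair of total length and total code
  lexicographically until the automorphism is Nielsen reduced; its inverse is then a signed
  permutation.\<close>

theorem nielsen_generation:
  assumes H: "subgroup H (Aut n)" and inv: "\<And>i. i < n \<Longrightarrow> inversion n i \<in> H"
    and tr: "\<And>i j. i < n \<Longrightarrow> j < n \<Longrightarrow> i \<noteq> j \<Longrightarrow> transvection n i j \<in> H"
  shows "H = carrier (Aut n)"
proof
  interpret A: group "Aut n" by (rule group_Aut)
  show "H \<subseteq> carrier (Aut n)" by (rule subgroup.subset[OF H])
  let ?L = "\<lambda>\<phi>. \<Sum>k<n. length (\<phi> (gen k))" and ?M = "\<lambda>\<phi>. \<Sum>k<n. half_code n (\<phi> (gen k))"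
  have "\<phi> \<in> carrier (Aut n) \<longrightarrow> \<phi> \<in> H" for \<phi>
  proof (induction \<phi> rule: wf_induct_rule[OF wf_measures[of "[?L, ?M]"]])
    case (1 \<phi>)
    show ?case
    proof
      assume \<phi>: "\<phi> \<in> carrier (Aut n)"
      show "\<phi> \<in> H"
      proof (cases "nielsen_reduced n \<phi>")
        case True
        have "inv\<^bsub>Aut n\<^esub> \<phi> \<in> H"
          using nielsen_reduced_inv_gen[OF \<phi> True] \<phi>
          by (intro signed_permutation_generation[OF H inv tr]) auto
        from subgroup.m_inv_closed[OF H this] show ?thesis using \<phi> by simp
      next
        case False
        from nielsen_step[OF \<phi> False] obtain x y where xy: "fst x < n" "fst y < n" "fst y \<noteq> fst x"
          and less: "let \<psi> = \<phi> \<otimes>\<^bsub>Aut n\<^esub> letter_transvection n y x in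
            ?L \<psi> < ?L \<phi> \<or> ?L \<psi> = ?L \<phi> \<and> ?M \<psi> < ?M \<phi>" by blast
        let ?t = "letter_transvection n y x"
        have t: "?t \<in> carrier (Aut n)" by (rule letter_transvection_closed[OF xy(2,1,3)])
        have "(\<phi> \<otimes>\<^bsub>Aut n\<^esub> ?t, \<phi>) \<in> measures [?L, ?M]"
          using less by (simp add: Let_def)
        then have "\<phi> \<otimes>\<^bsub>Aut n\<^esub> ?t \<in> H" using 1 \<phi> t by blast
        moreover have "?t \<in> H" using xy by (intro letter_transvection_subgroup[OF H] tr inv) auto
        ultimately have "\<phi> \<otimes>\<^bsub>Aut n\<^esub> ?t \<otimes>\<^bsub>Aut n\<^esub> inv\<^bsub>Aut n\<^esub> ?t \<in> H"
          using subgroup.m_closed[OF H] subgroup.m_inv_closed[OF H] by blast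
        then show ?thesis using \<phi> t by (simp add: A.m_assoc)
      qed
    qed
  qed
  then show "carrier (Aut n) \<subseteq> H" by blast
qed

section \<open>Commuting matrices of order dividing two or three\<close>

lemma subspace_vecI:
  fixes W :: "'k::field vec set"
  assumes "W \<subseteq> carrier_vec d" "0\<^sub>v d \<in> W" "\<And>v w. v \<in> W \<Longrightarrow> w \<in> W \<Longrightarrow> v + w \<in> W"
    "\<And>c v. v \<in> W \<Longrightarrow> c \<cdot>\<^sub>v v \<in> W"
  shows "subspace class_ring W (module_vec TYPE('k) d)"
proof (intro subspace.intro submodule.intro)
  show "vectorspace class_ring (module_vec TYPE('k) d)" by (rule vec_vs)
  show "module class_ring (module_vec TYPE('k) d)" by (rule vec_module)
qed (use assms in \<open>auto simp: module_vec_simps\<close>)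

text \<open>One coordinate of the computation that v + c A v + c^2 A^2 v is an eigenvector with
  eigenvalue c^2 if A^3 = 1.\<close>

lemma cube_root_rotate:
  fixes c :: "'k::comm_ring_1"
  assumes "c * (c * c) = 1"
  shows "x + (c * y + c * c * z) = c * c * (z + (c * x + c * c * y))"
proof -
  have "c * c * (z + (c * x + c * c * y)) = c * c * z + (c * (c * c)) * x + (c * (c * c)) * (c * y)"
    by (simp add: algebra_simps)
  then show ?thesis by (simp add: assms add.commute add.left_commute)
qed

section \<open>Simultaneous diagonalisation and counting\<close>

context vec_space
begin

lemma span_subset_closed:
  assumes "W \<subseteq> carrier_vec n" "0\<^sub>v n \<in> W" "\<And>v w. v \<in> W \<Longrightarrow> w \<in> W \<Longrightarrow> v + w \<in> W"
    "\<And>c v. v \<in> W \<Longrightarrow> c \<cdot>\<^sub>v v \<in> W" "B \<subseteq> W"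
  shows "span B \<subseteq> W"
  using subspace_vecI[OF assms(1-4)] assms(5) by (intro span_is_subset) (auto dest: is_module)

lemma eigen_closed:
  fixes A :: "'a mat"
  assumes "A \<in> carrier_mat n n"
  shows "0\<^sub>v n \<in> {v \<in> carrier_vec n. A *\<^sub>v v = c \<cdot>\<^sub>v v}"
    and "\<And>v w. A *\<^sub>v v = c \<cdot>\<^sub>v v \<Longrightarrow> A *\<^sub>v w = c \<cdot>\<^sub>v w \<Longrightarrow> v \<in> carrier_vec n \<Longrightarrow> w \<in> carrier_vec n \<Longrightarrow>
      A *\<^sub>v (v + w) = c \<cdot>\<^sub>v (v + w)"
    and "\<And>a v. A *\<^sub>v v = c \<cdot>\<^sub>v v \<Longrightarrow> v \<in> carrier_vec n \<Longrightarrow> A *\<^sub>v (a \<cdot>\<^sub>v v) = c \<cdot>\<^sub>v (a \<cdot>\<^sub>v v)"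
proof -
  show "0\<^sub>v n \<in> {v \<in> carrier_vec n. A *\<^sub>v v = c \<cdot>\<^sub>v v}"
    using assms by (auto intro!: eq_vecI)
  show "A *\<^sub>v (v + w) = c \<cdot>\<^sub>v (v + w)"
    if "A *\<^sub>v v = c \<cdot>\<^sub>v v" "A *\<^sub>v w = c \<cdot>\<^sub>v w" "v \<in> carrier_vec n" "w \<in> carrier_vec n" for v w
    using that mult_add_distrib_mat_vec[OF assms that(3,4)] smult_add_distrib_vec[OF that(3,4), of c] by simp
  show "A *\<^sub>v (a \<cdot>\<^sub>v v) = c \<cdot>\<^sub>v (a \<cdot>\<^sub>v v)" if "A *\<^sub>v v = c \<cdot>\<^sub>v v" "v \<in> carrier_vec n" for a v
    using that mult_mat_vec[OF assms that(2), of a] by (simp add: smult_smult_assoc mult.commute)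
qed

text \<open>Half the sum of v + A v and v - A v is v. The form relative to an invariant
  \<open>W\<close> allows the splitting to be repeated inside joint eigenspaces of other
  matrices.\<close>

lemma involution_eigen_span:
  assumes A: "A \<in> carrier_mat n n" and A2: "A * A = 1\<^sub>m n" and two: "(2 :: 'a) \<noteq> 0"
    and W: "W \<subseteq> carrier_vec n" "\<And>v w. v \<in> W \<Longrightarrow> w \<in> W \<Longrightarrow> v + w \<in> W"
      "\<And>c v. v \<in> W \<Longrightarrow> c \<cdot>\<^sub>v v \<in> W" "\<And>v. v \<in> W \<Longrightarrow> A *\<^sub>v v \<in> W" and v: "v \<in> W"
  shows "v \<in> span {w \<in> W. \<exists>c\<in>{1, -1}. A *\<^sub>v w = c \<cdot>\<^sub>v w}" (is "v \<in> span ?E")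
proof -
  have vc: "v \<in> carrier_vec n" using v W by auto
  let ?u = "A *\<^sub>v v"
  have u: "?u \<in> carrier_vec n" using A vc by auto
  have Au: "A *\<^sub>v ?u = v" using assoc_mult_mat_vec[OF A A vc] A2 vc by simp
  have E: "?E \<subseteq> carrier_vec n" using W by auto
  have half: "inverse 2 \<cdot>\<^sub>v ((a + 1 \<cdot>\<^sub>v b) + (a + (-1) \<cdot>\<^sub>v b)) = a"
    if "a \<in> carrier_vec n" "b \<in> carrier_vec n" for a b :: "'a vec"
    using that two by (intro eq_vecI) (auto simp: field_simps)
  have p: "v + c \<cdot>\<^sub>v ?u \<in> ?E" if c: "c = 1 \<or> c = -1" for c
  proof -
    have "A *\<^sub>v (v + c \<cdot>\<^sub>v ?u) = c \<cdot>\<^sub>v (v + c \<cdot>\<^sub>v ?u)"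
      using c by (subst mult_add_distrib_mat_vec[OF A vc])
        (use u vc A Au in \<open>auto simp: mult_mat_vec smult_add_distrib_vec smult_smult_assoc comm_add_vec\<close>)
    then show ?thesis using c v W by auto
  qed
  have "inverse 2 \<cdot>\<^sub>v ((v + 1 \<cdot>\<^sub>v ?u) + (v + (-1) \<cdot>\<^sub>v ?u)) = v"
    by (rule half[OF vc u])
  moreover have s: "v + 1 \<cdot>\<^sub>v ?u \<in> span ?E" "v + (-1) \<cdot>\<^sub>v ?u \<in> span ?E"
    using p[of 1] p[of "-1"] in_own_span[OF E] by blast+
  have "inverse 2 \<cdot>\<^sub>v ((v + 1 \<cdot>\<^sub>v ?u) + (v + (-1) \<cdot>\<^sub>v ?u)) \<in> span ?E"
    by (rule smult_in_span[OF E span_add1[OF E s]])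
  ultimately show ?thesis by simp
qed

text \<open>A discrete Fourier decomposition: the sums v + c A v + c^2 A^2 v over the three cube
  roots of unity c are eigenvectors and add up to 3 v, which is v in characteristic 2.\<close>

lemma order_three_eigen_span:
  assumes A: "A \<in> carrier_mat n n" and A3: "A * (A * A) = 1\<^sub>m n"
    and \<omega>: "1 + \<omega> + \<omega> * \<omega> = (0 :: 'a)" and two: "(2 :: 'a) = 0"
    and W: "W \<subseteq> carrier_vec n" "\<And>v w. v \<in> W \<Longrightarrow> w \<in> W \<Longrightarrow> v + w \<in> W"
      "\<And>c v. v \<in> W \<Longrightarrow> c \<cdot>\<^sub>v v \<in> W" "\<And>v. v \<in> W \<Longrightarrow> A *\<^sub>v v \<in> W" and v: "v \<in> W"
  shows "v \<in> span {w \<in> W. \<exists>c\<in>{1, \<omega>, \<omega> * \<omega>}. A *\<^sub>v w = c \<cdot>\<^sub>v w}" (is "v \<in> span ?E")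
proof -
  have vc: "v \<in> carrier_vec n" using v W by auto
  have w3: "\<omega> * (\<omega> * \<omega>) = 1" 
  proof -
    have "\<omega> * (\<omega> * \<omega>) - 1 = (\<omega> - 1) * (1 + \<omega> + \<omega> * \<omega>)" by (simp add: algebra_simps)
    then show ?thesis using \<omega> by simp
  qed
  have w4: "\<omega> * \<omega> * (\<omega> * \<omega>) = \<omega>" using w3 by (metis mult.assoc mult_1)
  let ?u = "A *\<^sub>v v" and ?t = "A *\<^sub>v (A *\<^sub>v v)"
  have u: "?u \<in> carrier_vec n" "?t \<in> carrier_vec n" using A vc by auto
  have At: "A *\<^sub>v ?t = v"
    using assoc_mult_mat_vec[OF A mult_carrier_mat[OF A A] vc] assoc_mult_mat_vec[OF A A vc] A3 vc by simp
  have E: "?E \<subseteq> carrier_vec n" using W by auto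
  let ?p = "\<lambda>c. v + (c \<cdot>\<^sub>v ?u + (c * c) \<cdot>\<^sub>v ?t)"
  have p: "?p c \<in> ?E" if c: "c * (c * c) = 1" "c * c \<in> {1, \<omega>, \<omega> * \<omega>}" for c
  proof -
    have "A *\<^sub>v ?p c = ?u + (c \<cdot>\<^sub>v ?t + (c * c) \<cdot>\<^sub>v v)"
      using A vc u by (simp add: mult_add_distrib_mat_vec[OF A] mult_mat_vec At)
    also have "x + (c \<cdot>\<^sub>v y + (c * c) \<cdot>\<^sub>v z) = (c * c) \<cdot>\<^sub>v (z + (c \<cdot>\<^sub>v x + (c * c) \<cdot>\<^sub>v y))"
      if xyz: "x \<in> carrier_vec n" "y \<in> carrier_vec n" "z \<in> carrier_vec n" for x y z
    proof -
      show ?thesis using xyz by (intro eq_vecI) (simp_all add: cube_root_rotate[OF c(1), symmetric])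
    qed
    note this[OF u vc]
    finally show ?thesis using c(2) v W by auto
  qed
  have "?p 1 + (?p \<omega> + ?p (\<omega> * \<omega>)) = v"
  proof (intro eq_vecI)
    fix i assume i: "i < dim_vec v"
    have i': "i < dim_vec ?u" "i < dim_vec ?t" "i < dim_row A" using i vc u A by auto
    let ?a = "v $ i" and ?b = "?u $ i" and ?c = "?t $ i"
    have "(?p 1 + (?p \<omega> + ?p (\<omega> * \<omega>))) $ i =
        ?a + (?b + ?c) + (?a + (\<omega> * ?b + \<omega> * \<omega> * ?c) + (?a + (\<omega> * \<omega> * ?b + \<omega> * \<omega> * (\<omega> * \<omega>) * ?c)))"
      using i i' vc u A by (simp del: index_mult_mat_vec)
    also have "\<dots> = ?a + 2 * ?a + (1 + \<omega> + \<omega> * \<omega>) * (?b + ?c)"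
      unfolding w4 by (simp add: algebra_simps)
    finally show "(?p 1 + (?p \<omega> + ?p (\<omega> * \<omega>))) $ i = ?a" using \<omega> two by simp
  qed (use vc u A in auto)
  moreover have "?p 1 + (?p \<omega> + ?p (\<omega> * \<omega>)) \<in> span ?E"
  proof -
    have "?p 1 \<in> ?E" "?p \<omega> \<in> ?E" "?p (\<omega> * \<omega>) \<in> ?E"
      using w3 w4 by (intro p; simp add: mult.assoc)+
    then have s: "?p 1 \<in> span ?E" "?p \<omega> \<in> span ?E" "?p (\<omega> * \<omega>) \<in> span ?E"
      using in_own_span[OF E] by blast+
    show ?thesis by (rule span_add1[OF E s(1) span_add1[OF E s(2,3)]])
  qed
  ultimately show ?thesis by simp
qed

text \<open>Matrices are added one at a time, each splitting the joint eigenvectors of the earlier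
  ones; commutativity keeps the joint eigenspaces invariant under the new matrix.\<close>

lemma joint_eigen_span:
  fixes S :: "'a mat set"
  assumes "finite S" and S: "S \<subseteq> carrier_mat n n"
    and comm: "\<And>A B. A \<in> S \<Longrightarrow> B \<in> S \<Longrightarrow> A * B = B * A"
    and split: "\<And>A W v. A \<in> S \<Longrightarrow> W \<subseteq> carrier_vec n \<Longrightarrow> (\<And>v w. v \<in> W \<Longrightarrow> w \<in> W \<Longrightarrow> v + w \<in> W) \<Longrightarrow>
      (\<And>c v. v \<in> W \<Longrightarrow> c \<cdot>\<^sub>v v \<in> W) \<Longrightarrow> (\<And>v. v \<in> W \<Longrightarrow> A *\<^sub>v v \<in> W) \<Longrightarrow> v \<in> W \<Longrightarrow>
      v \<in> span {w \<in> W. \<exists>c\<in>Z. A *\<^sub>v w = c \<cdot>\<^sub>v w}"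
  shows "carrier_vec n \<subseteq> span {v \<in> carrier_vec n. \<forall>A\<in>S. \<exists>c\<in>Z. A *\<^sub>v v = c \<cdot>\<^sub>v v}"
proof -
  let ?E = "\<lambda>T. {v \<in> carrier_vec n. \<forall>A\<in>T. \<exists>c\<in>Z. A *\<^sub>v v = c \<cdot>\<^sub>v v}"
  have "carrier_vec n \<subseteq> span (?E T)" if "T \<subseteq> S" for T
    using finite_subset[OF that \<open>finite S\<close>] that
  proof (induction T rule: finite_induct)
    case empty
    then show ?case using in_own_span[of "carrier_vec n"] by simp
  next
    case (insert A T)
    have A: "A \<in> S" "A \<in> carrier_mat n n" using insert.prems S by auto
    have "?E T \<subseteq> span (?E (insert A T))"
    proof
      fix v assume v: "v \<in> ?E T"
      \<comment> \<open>The set of joint eigenvectors is a union of subspaces and in general not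
        closed under addition; fixing the eigenvalues of \<open>v\<close> selects one of these
        subspaces, \<open>W\<close>.\<close>
      then obtain c where c: "\<And>B. B \<in> T \<Longrightarrow> c B \<in> Z \<and> B *\<^sub>v v = c B \<cdot>\<^sub>v v"
        using bchoice[of T "\<lambda>B z. z \<in> Z \<and> B *\<^sub>v v = z \<cdot>\<^sub>v v"] by auto
      define W where "W = {w \<in> carrier_vec n. \<forall>B\<in>T. B *\<^sub>v w = c B \<cdot>\<^sub>v w}"
      have B: "B \<in> carrier_mat n n" "A * B = B * A" if "B \<in> T" for B
        using that insert.prems S comm[OF A(1), of B] by auto
      have "v \<in> span {w \<in> W. \<exists>c\<in>Z. A *\<^sub>v w = c \<cdot>\<^sub>v w}"
      proof (rule split[OF A(1)])
        show "W \<subseteq> carrier_vec n" by (auto simp: W_def)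
        show "v + w \<in> W" if "v \<in> W" "w \<in> W" for v w
          using that eigen_closed(2) B by (auto simp: W_def)
        show "a \<cdot>\<^sub>v v \<in> W" if "v \<in> W" for a v
          using that eigen_closed(3) B by (auto simp: W_def)
        show "A *\<^sub>v w \<in> W" if "w \<in> W" for w
        proof -
          have w: "w \<in> carrier_vec n" using that by (simp add: W_def)
          have "B *\<^sub>v (A *\<^sub>v w) = c B \<cdot>\<^sub>v (A *\<^sub>v w)" if "B \<in> T" for B
          proof -
            have "B *\<^sub>v (A *\<^sub>v w) = A *\<^sub>v (B *\<^sub>v w)"
              using B[OF that] assoc_mult_mat_vec[OF B(1)[OF that] A(2) w]
                assoc_mult_mat_vec[OF A(2) B(1)[OF that] w] by simp
            then show ?thesis
              using \<open>w \<in> W\<close> that mult_mat_vec[OF A(2) w] by (simp add: W_def)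
          qed
          then show ?thesis using w A(2) by (auto simp: W_def)
        qed
        show "v \<in> W" using v c by (auto simp: W_def)
      qed
      moreover have "{w \<in> W. \<exists>c\<in>Z. A *\<^sub>v w = c \<cdot>\<^sub>v w} \<subseteq> ?E (insert A T)"
        using c by (auto simp: W_def)
      ultimately show "v \<in> span (?E (insert A T))" using span_is_monotone by blast
    qed
    then have "span (?E T) \<subseteq> span (?E (insert A T))" by (intro span_subsetI) auto
    then show ?case using insert by auto
  qed
  then show ?thesis by blast
qed

text \<open>An independent subset of \<open>E\<close> of greatest cardinality spans
  \<open>E\<close>; the dimension bounds the cardinalities, so a greatest one exists.\<close>

lemma exists_independent_spanning_subset:
  assumes E: "E \<subseteq> carrier_vec n"
  shows "\<exists>B \<subseteq> E. finite B \<and> card B \<le> n \<and> E \<subseteq> span B"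
proof -
  let ?P = "\<lambda>B. B \<subseteq> E \<and> lin_indpt B"
  have li: "finite B" "card B \<le> n" if "?P B" for B
    using li_le_dim[OF fin_dim _ conjunct2[OF that]] that E dim_is_n by auto
  have "?P {}" by (simp add: lin_dep_def)
  moreover have "\<forall>B. ?P B \<longrightarrow> card B < Suc n" using li(2) by (intro allI impI le_imp_less_Suc)
  ultimately have "\<exists>B. ?P B \<and> (\<forall>C. ?P C \<longrightarrow> card C \<le> card B)" by (rule ex_has_greatest_nat)
  then obtain B where B: "?P B" and max: "\<And>C. ?P C \<Longrightarrow> card C \<le> card B" by (elim exE conjE) simp
  have "E \<subseteq> span B"
  proof
    fix v assume v: "v \<in> E"
    show "v \<in> span B"
    proof (rule ccontr)
      assume nv: "v \<notin> span B"
      have BC: "B \<subseteq> carrier_vec n" using B E by auto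
      have "v \<notin> B" using nv in_own_span[OF BC] by auto
      moreover have "lin_indpt (B \<union> {v})"
        using lin_dep_iff_in_span[of B v] BC B v E \<open>v \<notin> B\<close> nv by auto
      ultimately have "card (B \<union> {v}) \<le> card B" using max[of "B \<union> {v}"] B v by auto
      then show False using \<open>v \<notin> B\<close> li(1)[OF B] by simp
    qed
  qed
  then show ?thesis using B li[OF B] by blast
qed

lemma mat_eq_on_vecs:
  fixes A B :: "'a mat"
  assumes A: "A \<in> carrier_mat n n" and B: "B \<in> carrier_mat n n"
    and "\<And>v. v \<in> carrier_vec n \<Longrightarrow> A *\<^sub>v v = B *\<^sub>v v"
  shows "A = B"
proof (rule eq_matI)
  fix i j assume "i < dim_row B" "j < dim_col B"
  then have ij: "i < n" "j < n" using B by auto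
  have "(A *\<^sub>v unit_vec n j) $ i = (B *\<^sub>v unit_vec n j) $ i" using assms(3)[of "unit_vec n j"] by simp
  then show "A $$ (i, j) = B $$ (i, j)" using A B ij by simp
qed (use A B in auto)

text \<open>A matrix in \<open>S\<close> is determined by its eigenvalues on a fixed spanning set of
  at most \<open>n\<close> joint eigenvectors, so \<open>S\<close> injects into the functions from
  that set to \<open>Z\<close>. The \<open>max 1\<close> keeps powers monotone in the exponent when
  \<open>Z\<close> is empty.\<close>

theorem card_diagonalizable_le:
  fixes S :: "'a mat set"
  assumes "finite S" and S: "S \<subseteq> carrier_mat n n" and "finite Z"
    and span: "carrier_vec n \<subseteq> span {v \<in> carrier_vec n. \<forall>A\<in>S. \<exists>c\<in>Z. A *\<^sub>v v = c \<cdot>\<^sub>v v}"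
  shows "card S \<le> max 1 (card Z) ^ n"
proof -
  let ?E = "{v \<in> carrier_vec n. \<forall>A\<in>S. \<exists>c\<in>Z. A *\<^sub>v v = c \<cdot>\<^sub>v v}"
  obtain B where B: "B \<subseteq> ?E" "finite B" "card B \<le> n" "?E \<subseteq> span B"
    using exists_independent_spanning_subset[of ?E] by blast
  have BC: "B \<subseteq> carrier_vec n" using B(1) by auto
  have full: "carrier_vec n \<subseteq> span B" using span span_subsetI[OF BC B(4)] by blast
  \<comment> \<open>Any suitable eigenvalue may be chosen: injectivity only uses that it reproduces
    the action on \<open>b\<close>.\<close>
  define ev where "ev A b = (SOME c. c \<in> Z \<and> A *\<^sub>v b = c \<cdot>\<^sub>v b)" for A b
  have ev: "ev A b \<in> Z \<and> A *\<^sub>v b = ev A b \<cdot>\<^sub>v b" if "A \<in> S" "b \<in> B" for A b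
    unfolding ev_def by (rule someI_ex) (use that B(1) in blast)
  have "inj_on (\<lambda>A. restrict (ev A) B) S"
  proof (rule inj_onI)
    fix A A' assume AA: "A \<in> S" "A' \<in> S" "restrict (ev A) B = restrict (ev A') B"
    have C: "A \<in> carrier_mat n n" "A' \<in> carrier_mat n n" using AA S by auto
    have "A *\<^sub>v b = A' *\<^sub>v b" if "b \<in> B" for b
      using ev[OF AA(1) that] ev[OF AA(2) that] fun_cong[OF AA(3), of b] that by simp
    then have "B \<subseteq> {v \<in> carrier_vec n. A *\<^sub>v v = A' *\<^sub>v v}" using BC by auto
    then have "span B \<subseteq> {v \<in> carrier_vec n. A *\<^sub>v v = A' *\<^sub>v v}"
      using C by (intro span_subset_closed)
        (auto simp: mult_add_distrib_mat_vec[of _ n n] mult_mat_vec[of _ n n])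
    then show "A = A'" using full C by (intro mat_eq_on_vecs) auto
  qed
  then have "card S \<le> card (PiE B (\<lambda>_. Z))"
    using \<open>finite Z\<close> B(2) ev by (intro card_inj_on_le[of _ S]) (auto intro: finite_PiE)
  also have "\<dots> = card Z ^ card B" using B(2) by (simp add: card_PiE)
  also have "\<dots> \<le> max 1 (card Z) ^ card B" by (rule power_mono) auto
  also have "\<dots> \<le> max 1 (card Z) ^ n" using B(3) by (intro power_increasing) auto
  finally show ?thesis .
qed

theorem card_commuting_involutions_le:
  fixes S :: "'a mat set"
  assumes "finite S" "S \<subseteq> carrier_mat n n" "\<And>A B. A \<in> S \<Longrightarrow> B \<in> S \<Longrightarrow> A * B = B * A"
    and "\<And>A. A \<in> S \<Longrightarrow> A * A = 1\<^sub>m n" and "(2 :: 'a) \<noteq> 0"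
  shows "card S \<le> 2 ^ n"
proof -
  have "carrier_vec n \<subseteq> span {v \<in> carrier_vec n. \<forall>A\<in>S. \<exists>c\<in>{1, -1}. A *\<^sub>v v = c \<cdot>\<^sub>v v}"
    using assms by (intro joint_eigen_span involution_eigen_span) auto
  then have "card S \<le> max 1 (card {1, -1 :: 'a}) ^ n"
    using assms by (intro card_diagonalizable_le) auto
  also have "\<dots> \<le> 2 ^ n" by (intro power_mono) (auto simp: card_insert_if)
  finally show ?thesis .
qed

theorem card_commuting_order_three_le:
  fixes S :: "'a mat set"
  assumes "finite S" "S \<subseteq> carrier_mat n n" "\<And>A B. A \<in> S \<Longrightarrow> B \<in> S \<Longrightarrow> A * B = B * A"
    and "\<And>A. A \<in> S \<Longrightarrow> A * (A * A) = 1\<^sub>m n" and "(2 :: 'a) = 0" and \<omega>: "1 + \<omega> + \<omega> * \<omega> = (0 :: 'a)"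
  shows "card S \<le> 3 ^ n"
proof -
  have "carrier_vec n \<subseteq> span {v \<in> carrier_vec n. \<forall>A\<in>S. \<exists>c\<in>{1, \<omega>, \<omega> * \<omega>}. A *\<^sub>v v = c \<cdot>\<^sub>v v}"
    using assms by (intro joint_eigen_span order_three_eigen_span) auto
  then have "card S \<le> max 1 (card {1, \<omega>, \<omega> * \<omega>}) ^ n"
    using assms by (intro card_diagonalizable_le) auto
  also have "\<dots> \<le> 3 ^ n" by (intro power_mono) (auto simp: card_insert_if)
  finally show ?thesis .
qed

end

section \<open>Block automorphisms\<close>

text \<open>On each block of two generators \<open>x, y\<close> an element of order \<open>q\<close> acts: for \<open>q = 2\<close> the swap,
  for \<open>q = 3\<close> the map \<open>x \<mapsto> y \<mapsto> (x y)\<^sup>-\<^sup>1\<close>. The word \<open>block_word q c k\<close> is the image of the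
  \<open>k\<close>-th generator under its \<open>c\<close>-th power.\<close>

definition block_word :: "nat \<Rightarrow> nat \<Rightarrow> nat \<Rightarrow> letter list" where
  "block_word q c k =
    (if c mod q = 0 then gen k
     else if q = 2 then gen (if even k then Suc k else k - 1)
     else if c mod q = 1 then if even k then gen (Suc k) else [(k, False), (k - 1, False)]
     else if even k then [(Suc k, False), (k, False)] else gen (k - 1))"

text \<open>For odd \<open>n\<close> the last generator lies in no block and stays fixed. Exponents
  are arbitrary naturals, read modulo \<open>q\<close>, so that composition simply adds
  them.\<close>

definition block_image :: "nat \<Rightarrow> nat \<Rightarrow> (nat \<Rightarrow> nat) \<Rightarrow> nat \<Rightarrow> letter list" where
  "block_image n q a k = (if k < 2 * (n div 2) then block_word q (a (k div 2)) k else gen k)"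

definition block_aut :: "nat \<Rightarrow> nat \<Rightarrow> (nat \<Rightarrow> nat) \<Rightarrow> letter list \<Rightarrow> letter list" where
  "block_aut n q a = free_endo n (block_image n q a)"

section \<open>Composition of block automorphisms\<close>

lemma block_image_support: "l \<in> fst ` set (block_image n q a k) \<Longrightarrow> l div 2 = k div 2"
  by (auto simp: block_image_def block_word_def split: if_splits elim!: evenE oddE)

lemma block_image_closed: "block_image n q a \<in> {..<n} \<rightarrow> carrier (free_group n)"
proof
  fix k assume "k \<in> {..<n}"
  moreover have "Suc k < n" if "k < 2 * (n div 2)" "even k" using that by presburger
  moreover have "0 < k" if "odd k" using that by (cases k) auto
  ultimately show "block_image n q a k \<in> carrier (free_group n)"
    by (auto simp: block_image_def block_word_def carrier_free_group letter_inv_def)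
qed

lemma block_image_even:
  assumes "i < n div 2"
  shows "block_image n q a (2 * i) = block_word q (a i) (2 * i)"
    "block_image n q a (Suc (2 * i)) = block_word q (a i) (Suc (2 * i))"
  using assms by (auto simp: block_image_def)

text \<open>Exponents add because \<open>block_word\<close> lists the powers of one map of order
  \<open>q\<close>; this is a finite check over the residues of the two exponents.\<close>

lemma free_endo_block_image:
  assumes q: "q = 2 \<or> q = 3" and k: "k < n"
  shows "free_endo n (block_image n q a) (block_image n q b k) = block_image n q (\<lambda>i. a i + b i) k"
proof (cases "k < 2 * (n div 2)")
  case False
  then show ?thesis using free_endo_hom(2)[OF block_image_closed k] by (simp add: block_image_def)
next
  case True
  define i where "i = k div 2"
  have i: "i < n div 2" using True by (simp add: i_def)
  have ki: "k = 2 * i \<or> k = Suc (2 * i)" unfolding i_def by presburger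
  let ?f = "block_image n q a"
  have n: "2 * i < n" "Suc (2 * i) < n" using i by auto
  have gen: "free_endo n ?f (gen (2 * i)) = block_word q (a i) (2 * i)"
    "free_endo n ?f (gen (Suc (2 * i))) = block_word q (a i) (Suc (2 * i))"
    using free_endo_hom(2)[OF block_image_closed n(1)] free_endo_hom(2)[OF block_image_closed n(2)]
    by (simp_all add: block_image_even[OF i])
  have "[(Suc (2 * i), False), (2 * i, False)] \<in> carrier (free_group n)"
    using n by (simp add: carrier_free_group letter_inv_def)
  then have two: "free_endo n ?f [(Suc (2 * i), False), (2 * i, False)] =
      foldr cancel_cons (word_inv (block_word q (a i) (Suc (2 * i))))
        (foldr cancel_cons (word_inv (block_word q (a i) (2 * i))) [])"
    by (simp add: free_endo_apply[OF block_image_closed] block_image_even[OF i])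
  let ?r = "a i mod q" and ?t = "b i mod q" and ?s = "(a i + b i) mod q"
  note simps = block_image_even[OF i] gen two block_word_def word_inv_def letter_inv_def
  show ?thesis
  proof (cases "q = 2")
    case True
    have "?r = 0 \<and> ?t = 0 \<and> ?s = 0 \<or>
      ?r = 0 \<and> ?t = 1 \<and> ?s = 1 \<or>
      ?r = 1 \<and> ?t = 0 \<and> ?s = 1 \<or>
      ?r = 1 \<and> ?t = 1 \<and> ?s = 0"
      unfolding True by presburger
    then show ?thesis using ki unfolding True by (elim disjE conjE) (simp_all add: simps[unfolded True])
  next
    case False
    then have "q = 3" using q by simp
    have "?r = 0 \<and> ?t = 0 \<and> ?s = 0 \<or>
      ?r = 0 \<and> ?t = 1 \<and> ?s = 1 \<or>
      ?r = 0 \<and> ?t = 2 \<and> ?s = 2 \<or>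
      ?r = 1 \<and> ?t = 0 \<and> ?s = 1 \<or>
      ?r = 1 \<and> ?t = 1 \<and> ?s = 2 \<or>
      ?r = 1 \<and> ?t = 2 \<and> ?s = 0 \<or>
      ?r = 2 \<and> ?t = 0 \<and> ?s = 2 \<or>
      ?r = 2 \<and> ?t = 1 \<and> ?s = 0 \<or>
      ?r = 2 \<and> ?t = 2 \<and> ?s = 1"
      unfolding \<open>q = 3\<close> by presburger
    then show ?thesis using ki unfolding \<open>q = 3\<close>
      by (elim disjE conjE) (simp_all add: simps[unfolded \<open>q = 3\<close>])
  qed
qed

lemma block_image_zero: "(\<And>i. a i mod q = 0) \<Longrightarrow> block_image n q a k = gen k"
  by (simp add: block_image_def block_word_def)

lemma block_aut_closed:
  assumes q: "q = 2 \<or> q = 3"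
  shows "block_aut n q a \<in> carrier (Aut n)"
proof -
  \<comment> \<open>Multiplying by \<open>q - 1\<close> serves as negation modulo \<open>q\<close>,
    the exponents being natural numbers.\<close>
  have "(\<lambda>i. a i + (q - 1) * a i) = (\<lambda>i. q * a i)" "(\<lambda>i. (q - 1) * a i + a i) = (\<lambda>i. q * a i)"
    using q by auto
  then show ?thesis
    unfolding block_aut_def using free_endo_block_image[OF q]
    by (intro free_endo_Aut[where g = "block_image n q (\<lambda>i. (q - 1) * a i)"] block_image_closed)
      (simp_all add: block_image_zero)
qed

lemma block_aut_gen: "k < n \<Longrightarrow> block_aut n q a (gen k) = block_image n q a k"
  unfolding block_aut_def by (rule free_endo_hom(2)[OF block_image_closed])

lemma block_aut_mult:
  assumes q: "q = 2 \<or> q = 3"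
  shows "block_aut n q a \<otimes>\<^bsub>Aut n\<^esub> block_aut n q b = block_aut n q (\<lambda>i. a i + b i)"
proof -
  interpret A: group "Aut n" by (rule group_Aut)
  note c = block_aut_closed[OF q]
  have "(block_aut n q a \<otimes>\<^bsub>Aut n\<^esub> block_aut n q b) (gen k) = block_image n q (\<lambda>i. a i + b i) k" if "k < n" for k
    using mult_Aut_apply[OF c c gen_closed[OF that]] free_endo_block_image[OF q that]
    by (simp add: block_aut_gen[OF that]) (simp add: block_aut_def)
  then show ?thesis using c by (intro Aut_eqI[where n = n]) (auto simp: block_aut_gen)
qed

lemma block_aut_one:
  assumes q: "q = 2 \<or> q = 3" and "\<And>i. a i mod q = 0"
  shows "block_aut n q a = \<one>\<^bsub>Aut n\<^esub>"
proof -
  interpret A: group "Aut n" by (rule group_Aut)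
  show ?thesis using block_aut_closed[OF q] assms
    by (intro Aut_eqI[where n = n]) (auto simp: block_aut_gen block_image_zero one_Aut_apply gen_closed)
qed

lemma inv_block_aut:
  assumes q: "q = 2 \<or> q = 3"
  shows "inv\<^bsub>Aut n\<^esub> block_aut n q a = block_aut n q (\<lambda>i. (q - 1) * a i)"
proof -
  interpret A: group "Aut n" by (rule group_Aut)
  have "(\<lambda>i. (q - 1) * a i + a i) = (\<lambda>i. q * a i)" using q by auto
  then show ?thesis
    using block_aut_mult[OF q, of n "\<lambda>i. (q - 1) * a i" a] block_aut_one[OF q, of "\<lambda>i. q * a i" n]
    by (intro A.inv_equality) (simp_all add: block_aut_closed[OF q])
qed

text \<open>The conjugate by \<open>g\<close> replaces the generator \<open>2 i\<close> by its partner \<open>2 i + 1\<close>, so that it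
  no longer interacts with the transvection that moves the generator \<open>2 i\<close>.\<close>

lemma block_conjugate_commutes:
  assumes q: "q = 2 \<or> q = 3" and ijk: "i < n div 2" "j < n div 2" "k < n div 2" "i \<noteq> j" "j \<noteq> k" "i \<noteq> k"
    and ci: "c i mod q = 1"
  defines "g \<equiv> block_aut n q c" and "T \<equiv> transvection n (2 * j) (2 * i)"
    and "M \<equiv> transvection n (2 * i) (2 * k)"
  defines "Y \<equiv> g \<otimes>\<^bsub>Aut n\<^esub> T \<otimes>\<^bsub>Aut n\<^esub> inv\<^bsub>Aut n\<^esub> g"
  shows "Y \<otimes>\<^bsub>Aut n\<^esub> M = M \<otimes>\<^bsub>Aut n\<^esub> Y"
proof -
  interpret A: group "Aut n" by (rule group_Aut)
  define g' where "g' = block_aut n q (\<lambda>i. (q - 1) * c i)"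
  have g'_eq: "inv\<^bsub>Aut n\<^esub> g = g'" by (simp add: g_def g'_def inv_block_aut[OF q])
  have n: "2 * i < n" "2 * j < n" "2 * k < n" "Suc (2 * i) < n" using ijk by auto
  have c: "g \<in> carrier (Aut n)" "g' \<in> carrier (Aut n)" "T \<in> carrier (Aut n)" "M \<in> carrier (Aut n)"
    using block_aut_closed[OF q] transvection_closed n ijk by (auto simp: g_def g'_def T_def M_def)
  have Y: "Y \<in> carrier (Aut n)" using c by (simp add: Y_def g'_eq)
  have sg: "l div 2 = x div 2" if "l \<in> fst ` set (g (gen x)) \<or> l \<in> fst ` set (g' (gen x))" "x < n" for l x
    using that(1) unfolding g_def g'_def block_aut_gen[OF that(2)] by (elim disjE) (rule block_image_support, assumption)+
  have gu: "g (gen (2 * i)) = gen (Suc (2 * i))"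
    using ci q n(1) ijk(1) unfolding g_def block_aut_gen[OF n(1)] block_image_even(1)[OF ijk(1)]
    by (auto simp: block_word_def)
  have Tg: "T (gen x) = (if x = 2 * j then [(2 * i, True), (2 * j, True)] else gen x)" if "x < n" for x
    using transvection_gen[of "2 * j" n "2 * i" x] n ijk that by (simp add: T_def)
  have Mg: "M (gen x) = (if x = 2 * i then [(2 * k, True), (2 * i, True)] else gen x)" if "x < n" for x
    using transvection_gen[of "2 * i" n "2 * k" x] n ijk that by (simp add: M_def)
  have Yx: "Y (gen x) = g (T (g' (gen x)))" and g'x: "g' (gen x) \<in> carrier (free_group n)"
    and Tg'x: "T (g' (gen x)) \<in> carrier (free_group n)" if "x < n" for x
  proof -
    show 1: "g' (gen x) \<in> carrier (free_group n)" by (rule Aut_closed[OF c(2) gen_closed[OF that]])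
    show 2: "T (g' (gen x)) \<in> carrier (free_group n)" by (rule Aut_closed[OF c(3) 1])
    show "Y (gen x) = g (T (g' (gen x)))"
      using mult_Aut_apply[OF A.m_closed[OF c(1,3)] c(2) gen_closed[OF that]] mult_Aut_apply[OF c(1,3) 1]
      by (simp add: Y_def g'_eq)
  qed
  have lt: "l < n" if "l \<in> fst ` set w" "w \<in> carrier (free_group n)" for l w
    using that by (auto simp: carrier_free_group)
  \<comment> \<open>The inverse of \<open>g\<close> keeps \<open>x\<close> inside its block,
    \<open>T\<close> fixes all generators outside block \<open>j\<close>, and \<open>g\<close>
    brings \<open>x\<close> back.\<close>
  have Y_fix: "Y (gen x) = gen x" if x: "x < n" "x div 2 \<noteq> j" for x
  proof -
    have "T (g' (gen x)) = g' (gen x)"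
    proof (rule Aut_fixes_word[OF c(3) g'x[OF x(1)]])
      fix l assume l: "l \<in> fst ` set (g' (gen x))"
      then have "l div 2 \<noteq> j" using sg[OF disjI2[OF l] x(1)] x(2) by simp
      then show "T (gen l) = gen l" using Tg[OF lt[OF l g'x[OF x(1)]]] by auto
    qed
    then show ?thesis
      using Yx[OF x(1)] inv_Aut_apply(2)[OF c(1) gen_closed[OF x(1)]] by (simp add: g'_eq)
  qed
  \<comment> \<open>Supports are traced through the three factors: \<open>g\<close> and its inverse
    preserve block \<open>j\<close>, \<open>T\<close> can add \<open>2 * i\<close>, and
    \<open>g\<close> turns this index into its partner.\<close>
  have Y_avoid: "2 * i \<notin> fst ` set (Y (gen x))" if x: "x < n" "x \<noteq> 2 * i" for x
  proof (cases "x div 2 = j")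
    case False
    then show ?thesis using Y_fix x by simp
  next
    case True
    have "fst ` set (T (g' (gen x))) \<subseteq> {l. l div 2 = j} \<union> {2 * i}"
    proof (rule Aut_support[OF c(3) g'x[OF x(1)]])
      fix l assume l: "l \<in> fst ` set (g' (gen x))"
      then have "l div 2 = j" using sg[OF disjI2[OF l] x(1)] True by simp
      then show "fst ` set (T (gen l)) \<subseteq> {l. l div 2 = j} \<union> {2 * i}"
        using Tg[OF lt[OF l g'x[OF x(1)]]] by auto
    qed
    note T_supp = this
    have "fst ` set (g (T (g' (gen x)))) \<subseteq> {l. l div 2 = j} \<union> {Suc (2 * i)}"
    proof (rule Aut_support[OF c(1) Tg'x[OF x(1)]])
      fix l assume l: "l \<in> fst ` set (T (g' (gen x)))"
      then have "l div 2 = j \<or> l = 2 * i" using T_supp by blast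
      then show "fst ` set (g (gen l)) \<subseteq> {l. l div 2 = j} \<union> {Suc (2 * i)}"
      proof
        assume "l div 2 = j"
        then show ?thesis using sg[OF disjI1 lt[OF l Tg'x[OF x(1)]]] by blast
      qed (simp add: gu)
    qed
    then show ?thesis using Yx[OF x(1)] ijk by auto
  qed
  \<comment> \<open>\<open>M\<close> moves only generator \<open>2 * i\<close>, to a word in
    \<open>2 * k\<close> and \<open>2 * i\<close>, both fixed by \<open>Y\<close>; every other
    generator has an image under \<open>Y\<close> that is free of \<open>2 * i\<close>.\<close>
  show ?thesis
  proof (rule Aut_eqI[where n = n])
    fix x assume x: "x < n"
    have "Y (M (gen x)) = M (Y (gen x))"
    proof (cases "x = 2 * i")
      case True
      have w: "[(2 * k, True), (2 * i, True)] \<in> carrier (free_group n)"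
        using n ijk by (simp add: carrier_free_group letter_inv_def)
      have "Y [(2 * k, True), (2 * i, True)] = [(2 * k, True), (2 * i, True)]"
        using Aut_apply_two_letters[OF Y w] Y_fix[OF n(1)] Y_fix[OF n(3)] ijk by (simp add: letter_inv_def)
      then show ?thesis using True Mg[OF x] Y_fix[OF x] ijk by simp
    next
      case False
      have Yc: "Y (gen x) \<in> carrier (free_group n)" by (rule Aut_closed[OF Y gen_closed[OF x]])
      have "M (Y (gen x)) = Y (gen x)"
        by (rule Aut_fixes_word[OF c(4) Yc]) (use Y_avoid[OF x False] Mg lt[OF _ Yc] in \<open>metis\<close>)
      then show ?thesis using Mg[OF x] False by simp
    qed
    then show "(Y \<otimes>\<^bsub>Aut n\<^esub> M) (gen x) = (M \<otimes>\<^bsub>Aut n\<^esub> Y) (gen x)"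
      by (simp add: mult_Aut_apply[OF Y c(4) gen_closed[OF x]] mult_Aut_apply[OF c(4) Y gen_closed[OF x]])
  qed (use Y c in auto)
qed

section \<open>Low-dimensional representations\<close>

lemma carrier_GL: "A \<in> carrier (GL TYPE('k::field) d) \<Longrightarrow> A \<in> carrier_mat d d"
  by (auto simp: GL_def units_of_def Units_def ring_mat_def)

lemma mult_GL: "A \<otimes>\<^bsub>GL TYPE('k::field) d\<^esub> B = A * B"
  by (simp add: GL_def units_of_def ring_mat_def)

lemma one_GL: "\<one>\<^bsub>GL TYPE('k::field) d\<^esub> = 1\<^sub>m d"
  by (simp add: GL_def units_of_def ring_mat_def)

text \<open>Algebraic closure supplies a root of 1 + X + X^2, in characteristic 2 a primitive cube
  root of unity; elements of order 3 can then replace involutions.\<close>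

lemma exists_order_coprime_to_char:
  obtains "(2 :: 'k::alg_closed_field) \<noteq> 0"
  | \<omega> where "(2 :: 'k::alg_closed_field) = 0" "1 + \<omega> + \<omega> * \<omega> = (0 :: 'k)"
proof -
  obtain \<omega> :: 'k where "poly [:1, 1, 1:] \<omega> = 0"
    using alg_closed_imp_poly_has_root[of "[:1, 1, 1 :: 'k:]"] by auto
  then have "1 + \<omega> + \<omega> * \<omega> = 0" by (simp add: algebra_simps)
  then show ?thesis using that by blast
qed

text \<open>There are \<open>q ^ (n div 2)\<close> block automorphisms, but a commuting family of \<open>d \<times> d\<close> matrices
  of order dividing \<open>q\<close> has at most \<open>q ^ d\<close> members.\<close>

lemma block_aut_in_kernel:
  fixes \<rho> :: "(letter list \<Rightarrow> letter list) \<Rightarrow> 'k::alg_closed_field mat"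
  assumes \<rho>: "\<rho> \<in> hom (Aut n) (GL TYPE('k) d)" and d: "d < n div 2"
  shows "\<exists>q c i. (q = 2 \<or> q = 3) \<and> i < n div 2 \<and> c i mod q = 1 \<and> \<rho> (block_aut n q c) = 1\<^sub>m d"
proof -
  interpret A: group "Aut n" by (rule group_Aut)
  interpret \<rho>: group_hom "Aut n" "GL TYPE('k) d" \<rho>
    using \<rho> by (simp add: group_hom_def group_hom_axioms_def group_Aut group_GL)
  interpret V: vec_space "TYPE('k)" d .
  let ?m = "n div 2"
  \<comment> \<open>Taking the exponent functions extensional on the set of blocks makes their
    number exactly \<open>q ^ ?m\<close>.\<close>
  let ?D = "\<lambda>q. PiE {..<?m} (\<lambda>_. {..<q :: nat})"
  let ?S = "\<lambda>q. (\<lambda>a. \<rho> (block_aut n q a)) ` ?D q"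
  have fin: "finite (?D q)" "finite (?S q)" for q by (auto intro!: finite_PiE)
  have mult: "\<rho> (block_aut n q a) * \<rho> (block_aut n q b) = \<rho> (block_aut n q (\<lambda>i. a i + b i))"
    if q: "q = 2 \<or> q = 3" for q a b
    using \<rho>.hom_mult[OF block_aut_closed[OF q] block_aut_closed[OF q]] by (simp add: mult_GL block_aut_mult[OF q])
  have one: "\<rho> (block_aut n q a) = 1\<^sub>m d" if q: "q = 2 \<or> q = 3" and "\<And>i. a i mod q = 0" for q a
    using \<rho>.hom_one block_aut_one[OF that, of n] by (simp add: one_GL)
  have S: "?S q \<subseteq> carrier_mat d d" if q: "q = 2 \<or> q = 3" for q
    using carrier_GL[OF \<rho>.hom_closed[OF block_aut_closed[OF q]]] by auto
  have comm: "A * B = B * A" if q: "q = 2 \<or> q = 3" and AB: "A \<in> ?S q" "B \<in> ?S q" for q A B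
  proof -
    obtain a b where ab: "A = \<rho> (block_aut n q a)" "B = \<rho> (block_aut n q b)" using AB by auto
    have "(\<lambda>i. a i + b i) = (\<lambda>i. b i + a i)" by (rule ext) simp
    then show ?thesis by (simp only: ab mult[OF q])
  qed
  have "\<exists>q. (q = 2 \<or> q = 3) \<and> card (?S q) \<le> q ^ d"
  proof (rule exists_order_coprime_to_char[where 'k = 'k])
    assume two: "(2 :: 'k) \<noteq> 0"
    have "A * A = 1\<^sub>m d" if A: "A \<in> ?S 2" for A
    proof -
      obtain a where a: "A = \<rho> (block_aut n 2 a)" using A by blast
      have "\<rho> (block_aut n 2 (\<lambda>i. a i + a i)) = 1\<^sub>m d" by (rule one) simp_all
      then show ?thesis using mult[of 2 a a] a by simp
    qed
    then have "card (?S 2) \<le> 2 ^ d"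
      using V.card_commuting_involutions_le[OF fin(2) S[of 2] comm[of 2] _ two] by auto
    then show ?thesis by blast
  next
    fix \<omega> :: 'k assume \<omega>: "(2 :: 'k) = 0" "1 + \<omega> + \<omega> * \<omega> = 0"
    have "A * (A * A) = 1\<^sub>m d" if A: "A \<in> ?S 3" for A
    proof -
      obtain a where a: "A = \<rho> (block_aut n 3 a)" using A by blast
      have "\<rho> (block_aut n 3 (\<lambda>i. a i + (a i + a i))) = 1\<^sub>m d"
        by (rule one) (simp, presburger)
      then show ?thesis using mult[of 3 a a] mult[of 3 a "\<lambda>i. a i + a i"] a by simp
    qed
    then have "card (?S 3) \<le> 3 ^ d"
      using V.card_commuting_order_three_le[OF fin(2) S[of 3] comm[of 3] _ \<omega>] by auto
    then show ?thesis by blast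
  qed
  then obtain q where q: "q = 2 \<or> q = 3" and le: "card (?S q) \<le> q ^ d" by blast
  have "q ^ d < q ^ ?m" using q d by (intro power_strict_increasing) auto
  then have "card (?S q) < card (?D q)" using le by (simp add: card_PiE)
  then have "\<not> inj_on (\<lambda>a. \<rho> (block_aut n q a)) (?D q)" using card_image by fastforce
  then obtain a b where ab: "a \<in> ?D q" "b \<in> ?D q" "a \<noteq> b" "\<rho> (block_aut n q a) = \<rho> (block_aut n q b)"
    unfolding inj_on_def by blast
  then obtain i where i: "i < ?m" "a i \<noteq> b i" by (metis PiE_ext lessThan_iff)
  have ai: "a i < q" "b i < q" using ab i by (auto simp: PiE_iff)
  \<comment> \<open>Modulo \<open>q\<close> this is the difference of \<open>a\<close> and
    \<open>b\<close>, with \<open>q - 1\<close> in place of -1. It is nonzero at \<open>i\<close>;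
    the residue 2, possible for \<open>q = 3\<close>, becomes 1 on doubling, whence
    \<open>c\<close>.\<close>
  define e where "e = (\<lambda>k. a k + (q - 1) * b k)"
  define c where "c = (\<lambda>k. if e i mod q = 1 then e k else e k + e k)"
  have "c i mod q = 1"
  proof (cases "q = 2")
    case True
    then show ?thesis using ai i(2) unfolding c_def e_def by auto
  next
    case False
    then have "q = 3" using q by simp
    then have "a i \<in> {0, 1, 2}" "b i \<in> {0, 1, 2}" using ai by auto
    then show ?thesis using i(2) \<open>q = 3\<close> unfolding c_def e_def by auto
  qed
  moreover have "\<rho> (block_aut n q c) = 1\<^sub>m d"
  proof -
    have "\<rho> (block_aut n q e) = \<rho> (block_aut n q a) * \<rho> (block_aut n q (\<lambda>k. (q - 1) * b k))"
      by (simp add: e_def mult[OF q])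
    also have "\<dots> = \<rho> (block_aut n q (\<lambda>k. b k + (q - 1) * b k))" by (simp add: ab(4) mult[OF q])
    also have "(\<lambda>k. b k + (q - 1) * b k) = (\<lambda>k. q * b k)" using q by auto
    also have "\<rho> (block_aut n q (\<lambda>k. q * b k)) = 1\<^sub>m d" by (rule one[OF q]) simp
    finally have e: "\<rho> (block_aut n q e) = 1\<^sub>m d" .
    then have "\<rho> (block_aut n q (\<lambda>k. e k + e k)) = 1\<^sub>m d" using mult[OF q, of e e] by simp
    with e show ?thesis by (cases "e i mod q = 1") (simp_all add: c_def)
  qed
  ultimately show ?thesis using q i(1) by blast
qed

section \<open>Homomorphisms that kill transvections\<close>

context
  fixes n :: nat and G :: "('g, 'b) monoid_scheme" and h
  assumes h: "group_hom (Aut n) G h"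
begin

interpretation h: group_hom "Aut n" G h by (rule h)

lemma transvection_kernel_of_commuting:
  assumes "i < n" "j < n" "k < n" "i \<noteq> j" "j \<noteq> k" "i \<noteq> k"
    and "h (transvection n i j) \<otimes>\<^bsub>G\<^esub> h (transvection n j k) =
      h (transvection n j k) \<otimes>\<^bsub>G\<^esub> h (transvection n i j)"
  shows "h (transvection n i k) = \<one>\<^bsub>G\<^esub>"
proof -
  have c: "transvection n i j \<in> carrier (Aut n)" "transvection n j k \<in> carrier (Aut n)"
    "transvection n i k \<in> carrier (Aut n)" using assms by (auto intro: transvection_closed)
  have "h (transvection n j k) \<otimes>\<^bsub>G\<^esub> h (transvection n i j) =
    h (transvection n i j) \<otimes>\<^bsub>G\<^esub> h (transvection n j k) \<otimes>\<^bsub>G\<^esub> h (transvection n i k)"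
    using arg_cong[OF transvection_commutator[OF assms(1-6)], of h] c by simp
  then have "h (transvection n i j) \<otimes>\<^bsub>G\<^esub> h (transvection n j k) \<otimes>\<^bsub>G\<^esub> h (transvection n i k) =
    h (transvection n i j) \<otimes>\<^bsub>G\<^esub> h (transvection n j k)"
    using assms(7) by simp
  then show ?thesis
    by (subst (asm) h.H.l_cancel_one) (use c in auto)
qed

text \<open>A killed transvection commutes in the image with every other, so killing spreads along
  the commutator relation: first to the transvections moving \<open>z\<close>, then to those not
  multiplying by \<open>z\<close>, and finally, through a third index, to those multiplying by
  \<open>z\<close>.\<close>

lemma transvections_in_kernel:
  assumes zuw: "z < n" "u < n" "w < n" "z \<noteq> u" "u \<noteq> w" "z \<noteq> w"
    and comm: "h (transvection n z u) \<otimes>\<^bsub>G\<^esub> h (transvection n u w) =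
      h (transvection n u w) \<otimes>\<^bsub>G\<^esub> h (transvection n z u)"
    and "i < n" "j < n" "i \<noteq> j"
  shows "h (transvection n i j) = \<one>\<^bsub>G\<^esub>"
proof -
  let ?K = "\<lambda>i j. h (transvection n i j) = \<one>\<^bsub>G\<^esub>"
  have cl: "h (transvection n i j) \<in> carrier G" if "i < n" "j < n" "i \<noteq> j" for i j
    using that transvection_closed by simp
  have step: "?K a c" if "a < n" "b < n" "c < n" "a \<noteq> b" "b \<noteq> c" "a \<noteq> c" "?K a b \<or> ?K b c" for a b c
    using that cl[of a b] cl[of b c] by (intro transvection_kernel_of_commuting[of a b c]) auto
  have zw: "?K z w" using transvection_kernel_of_commuting[OF zuw comm] .
  have z: "?K z k" if "k < n" "k \<noteq> z" for k
    using step[of z w k] zw zuw that by (cases "k = w") auto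
  have nz: "?K i k" if "i < n" "k < n" "i \<noteq> k" "k \<noteq> z" for i k
    using step[of i z k] z[of k] zuw that by (cases "i = z") auto
  have "?K i z" if "i < n" "i \<noteq> z" for i
  proof -
    obtain k where "k < n" "k \<noteq> i" "k \<noteq> z" using zuw by metis
    then show ?thesis using step[of i k z] nz[of i k] zuw that by auto
  qed
  then show ?thesis using nz assms by (cases "j = z") auto
qed

text \<open>\<open>signed_swap\<close> is a product of transvections of letters, hence killed, and
  it conjugates one inversion into the other.\<close>

lemma inversions_equal:
  assumes K: "\<And>i j. i < n \<Longrightarrow> j < n \<Longrightarrow> i \<noteq> j \<Longrightarrow> h (transvection n i j) = \<one>\<^bsub>G\<^esub>"
    and ij: "i < n" "j < n"
  shows "h (inversion n i) = h (inversion n j)"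
proof (cases "i = j")
  case False
  have lt: "h (letter_transvection n x y) = \<one>\<^bsub>G\<^esub>" if "fst x < n" "fst y < n" "fst x \<noteq> fst y" for x y
  proof -
    note T = transvection_closed[OF that] and e = inversion_closed[OF that(1)]
    have "h (inversion n (fst x)) \<otimes>\<^bsub>G\<^esub> h (inversion n (fst x)) = \<one>\<^bsub>G\<^esub>"
      using h.hom_mult[OF e e] inversion_square[OF that(1)] by simp
    then show ?thesis using T e K[OF that] by (simp add: letter_transvection_def Let_def)
  qed
  note c = letter_transvection_closed
  have s: "h (signed_swap n i j) = \<one>\<^bsub>G\<^esub>"
    using ij False c[of "(i, True)" n "(j, True)"] c[of "(j, True)" n "(i, False)"]
      c[of "(i, False)" n "(j, False)"] by (simp add: signed_swap_def lt)
  note sc = signed_swap_closed[OF ij False] and e = inversion_closed[OF ij(1)] inversion_closed[OF ij(2)]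
  show ?thesis
    using arg_cong[OF signed_swap_inversion[OF ij False], of h] sc e s by simp
qed simp

end

text \<open>The automorphisms on which \<open>f\<close> and \<open>g\<close> agree form a subgroup,
  which by Nielsen's theorem is everything.\<close>

lemma homs_agree:
  assumes f: "group_hom (Aut n) G f" and g: "group_hom (Aut n) G g"
    and tr: "\<And>i j. i < n \<Longrightarrow> j < n \<Longrightarrow> i \<noteq> j \<Longrightarrow> f (transvection n i j) = g (transvection n i j)"
    and inv: "\<And>i. i < n \<Longrightarrow> f (inversion n i) = g (inversion n i)"
    and "\<phi> \<in> carrier (Aut n)"
  shows "f \<phi> = g \<phi>"
proof -
  interpret f: group_hom "Aut n" G f by (rule f)
  interpret g: group_hom "Aut n" G g by (rule g)
  let ?H = "{\<phi> \<in> carrier (Aut n). f \<phi> = g \<phi>}"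
  have "subgroup ?H (Aut n)" by (rule f.G.subgroupI) (auto intro: exI[of _ "\<one>\<^bsub>Aut n\<^esub>"])
  then have "?H = carrier (Aut n)"
    using tr inv by (intro nielsen_generation) (auto simp: transvection_closed inversion_closed)
  then show ?thesis using assms(5) by blast
qed

text \<open>As \<open>A\<close> squares to one, the preimage of one and \<open>A\<close> is a
  subgroup, and it contains Nielsen's generators.\<close>

lemma hom_two_values:
  assumes f: "group_hom (Aut n) G f" and A: "A \<in> carrier G" "A \<otimes>\<^bsub>G\<^esub> A = \<one>\<^bsub>G\<^esub>"
    and tr: "\<And>i j. i < n \<Longrightarrow> j < n \<Longrightarrow> i \<noteq> j \<Longrightarrow> f (transvection n i j) = \<one>\<^bsub>G\<^esub>"
    and inv: "\<And>i. i < n \<Longrightarrow> f (inversion n i) = A"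
    and "\<phi> \<in> carrier (Aut n)"
  shows "f \<phi> = \<one>\<^bsub>G\<^esub> \<or> f \<phi> = A"
proof -
  interpret f: group_hom "Aut n" G f by (rule f)
  let ?H = "{\<phi> \<in> carrier (Aut n). f \<phi> = \<one>\<^bsub>G\<^esub> \<or> f \<phi> = A}"
  have "inv\<^bsub>G\<^esub> A = A" using A by (intro f.H.inv_equality)
  then have "subgroup ?H (Aut n)"
    using A by (intro f.G.subgroupI) (auto intro: exI[of _ "\<one>\<^bsub>Aut n\<^esub>"])
  then have "?H = carrier (Aut n)"
    using tr inv by (intro nielsen_generation) (auto simp: transvection_closed inversion_closed)
  then show ?thesis using assms(6) by blast
qed

text \<open>\<open>f\<close> separates the classes, so one chosen preimage for each of its finitely
  many values meets every class.\<close>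

lemma finite_quotientI:
  assumes "equiv A r" "finite (f ` A)" "\<And>x y. x \<in> A \<Longrightarrow> y \<in> A \<Longrightarrow> f x = f y \<Longrightarrow> (x, y) \<in> r"
  shows "finite (A // r)"
proof -
  have "A // r \<subseteq> (\<lambda>v. r `` {inv_into A f v}) ` f ` A"
  proof
    fix X assume "X \<in> A // r"
    then obtain x where x: "x \<in> A" "X = r `` {x}" by (auto elim: quotientE)
    have "(inv_into A f (f x), x) \<in> r"
      using x by (intro assms(3)) (auto simp: inv_into_into f_inv_into_f)
    then have "X = r `` {inv_into A f (f x)}" using x equiv_class_eq[OF assms(1)] by metis
    then show "X \<in> (\<lambda>v. r `` {inv_into A f v}) ` f ` A" using x by blast
  qed
  then show ?thesis using assms(2) by (meson finite_imageI finite_subset)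
qed

section \<open>Determination of the irreducible representations\<close>

lemma transvection_rep_trivial:
  fixes \<rho> :: "(letter list \<Rightarrow> letter list) \<Rightarrow> 'k::alg_closed_field mat"
  assumes n: "n \<ge> 4" and d: "d \<ge> 1" "int d \<le> 2 * \<lfloor>real n / 4\<rfloor> - 1"
    and \<rho>: "group_hom (Aut n) (GL TYPE('k) d) \<rho>" and ij: "i < n" "j < n" "i \<noteq> j"
  shows "\<rho> (transvection n i j) = \<one>\<^bsub>GL TYPE('k) d\<^esub>"
proof -
  interpret \<rho>: group_hom "Aut n" "GL TYPE('k) d" \<rho> by (rule \<rho>)
  have fl: "\<lfloor>real n / 4\<rfloor> = int (n div 4)" using floor_divide_of_nat_eq[of n 4, where ?'a = real] by simp
  have "\<exists>z u w. z < n \<and> u < n \<and> w < n \<and> z \<noteq> u \<and> u \<noteq> w \<and> z \<noteq> w \<and>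
    \<rho> (transvection n z u) * \<rho> (transvection n u w) = \<rho> (transvection n u w) * \<rho> (transvection n z u)"
  proof (cases "n < 8")
    \<comment> \<open>For 4 \<le> n < 8 the bound forces \<open>d = 1\<close>, where matrices
      commute. There may be only two blocks here, whereas the block argument uses three.\<close>
    case True
    then have "n div 4 = 1" using n by auto
    then have d1: "d = 1" using d fl by simp
    have C: "\<rho> (transvection n 0 1) \<in> carrier_mat 1 1" "\<rho> (transvection n 1 2) \<in> carrier_mat 1 1"
      using carrier_GL[OF \<rho>.hom_closed[OF transvection_closed], of 0 1]
        carrier_GL[OF \<rho>.hom_closed[OF transvection_closed], of 1 2] n d1 by auto
    have "\<rho> (transvection n 0 1) * \<rho> (transvection n 1 2) = \<rho> (transvection n 1 2) * \<rho> (transvection n 0 1)"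
      using C by (intro eq_matI) (auto simp: scalar_prod_def)
    then show ?thesis using n by (intro exI[of _ 0] exI[of _ 1] exI[of _ 2]) auto
  next
    case False
    have "d < n div 2" using d fl by linarith
    then obtain q c i where q: "q = 2 \<or> q = 3" and i: "i < n div 2" and ci: "c i mod q = 1"
      and ker: "\<rho> (block_aut n q c) = 1\<^sub>m d"
      using block_aut_in_kernel[OF \<rho>.homh] by blast
    have "\<exists>j. j < n div 2 \<and> j \<noteq> i"
      using False by (intro exI[of _ "if i = 0 then 1 else 0"]) auto
    then obtain j where j: "j < n div 2" "j \<noteq> i" by blast
    have "\<exists>k. k < n div 2 \<and> k \<noteq> i \<and> k \<noteq> j"
      using False by (intro exI[of _ "if i \<noteq> 0 \<and> j \<noteq> 0 then 0 else if i \<noteq> 1 \<and> j \<noteq> 1 then 1 else 2"]) auto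
    then obtain k where k: "k < n div 2" "k \<noteq> i" "k \<noteq> j" by blast
    let ?g = "block_aut n q c" and ?T = "transvection n (2 * j) (2 * i)" and ?M = "transvection n (2 * i) (2 * k)"
    have N: "2 * i < n" "2 * j < n" "2 * k < n" using i j k by auto
    have g: "?g \<in> carrier (Aut n)" and T: "?T \<in> carrier (Aut n)" and M: "?M \<in> carrier (Aut n)"
      using block_aut_closed[OF q] transvection_closed N j k by auto
    let ?Y = "?g \<otimes>\<^bsub>Aut n\<^esub> ?T \<otimes>\<^bsub>Aut n\<^esub> inv\<^bsub>Aut n\<^esub> ?g"
    have Y: "?Y \<in> carrier (Aut n)" using g T by simp
    have "?Y \<otimes>\<^bsub>Aut n\<^esub> ?M = ?M \<otimes>\<^bsub>Aut n\<^esub> ?Y"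
      using i j k ci by (intro block_conjugate_commutes[OF q, of i n j k c]) auto
    then have "\<rho> ?Y * \<rho> ?M = \<rho> ?M * \<rho> ?Y"
      using \<rho>.hom_mult[OF Y M] \<rho>.hom_mult[OF M Y] by (simp add: mult_GL)
    \<comment> \<open>Conjugation by an element of the kernel does not change the image, so
      commuting with the image of \<open>?M\<close> passes from \<open>?Y\<close> to
      \<open>?T\<close>.\<close>
    moreover have "\<rho> ?Y = \<rho> ?T" using g T ker by (simp add: one_GL[symmetric])
    ultimately show ?thesis using N j k by (intro exI[of _ "2 * j"] exI[of _ "2 * i"] exI[of _ "2 * k"]) auto
  qed
  then obtain z u w where zuw: "z < n" "u < n" "w < n" "z \<noteq> u" "u \<noteq> w" "z \<noteq> w"
    and comm: "\<rho> (transvection n z u) * \<rho> (transvection n u w) =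
      \<rho> (transvection n u w) * \<rho> (transvection n z u)" by blast
  show ?thesis by (rule transvections_in_kernel[OF \<rho> zuw _ ij]) (simp add: mult_GL comm)
qed

text \<open>The vectors fixed by \<open>A\<close> are fixed by every \<open>\<rho> g\<close>, so
  they form an invariant subspace. If it is everything, \<open>A\<close> is the identity; if it is
  zero, v + A v vanishes for every v, being fixed by \<open>A\<close>, and \<open>A\<close> is minus
  the identity.\<close>

lemma irreducible_rep_sign:
  fixes \<rho> :: "'g \<Rightarrow> 'k::field mat"
  assumes irr: "irreducible_rep G d \<rho>" and A: "A \<in> carrier_mat d d" "A * A = 1\<^sub>m d"
    and two: "\<And>g. g \<in> carrier G \<Longrightarrow> \<rho> g = 1\<^sub>m d \<or> \<rho> g = A"
  shows "A = 1\<^sub>m d \<or> A = (-1) \<cdot>\<^sub>m 1\<^sub>m d"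
proof -
  interpret V: vec_space "TYPE('k)" d .
  let ?W = "{v \<in> carrier_vec d. A *\<^sub>v v = 1 \<cdot>\<^sub>v v}"
  have "subspace class_ring ?W (module_vec TYPE('k) d)"
    using V.eigen_closed[OF A(1), where c = 1] by (intro subspace_vecI) auto
  moreover have "\<forall>g \<in> carrier G. \<forall>w \<in> ?W. \<rho> g *\<^sub>v w \<in> ?W"
  proof (intro ballI)
    fix g w assume g: "g \<in> carrier G" and w: "w \<in> ?W"
    have "\<rho> g *\<^sub>v w = w" using two[OF g] w by auto
    then show "\<rho> g *\<^sub>v w \<in> ?W" using w by simp
  qed
  ultimately consider "?W = {0\<^sub>v d}" | "?W = carrier_vec d"
    using irr unfolding irreducible_rep_def by blast
  then show ?thesis
  proof cases
    case 1
    have "A *\<^sub>v v = ((-1) \<cdot>\<^sub>m 1\<^sub>m d) *\<^sub>v v" if v: "v \<in> carrier_vec d" for v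
    proof -
      let ?u = "A *\<^sub>v v"
      have u: "?u \<in> carrier_vec d" using A v by auto
      have "A *\<^sub>v (?u + v) = v + ?u"
        using mult_add_distrib_mat_vec[OF A(1) u v] assoc_mult_mat_vec[OF A(1) A(1) v] A(2) v by simp
      then have "?u + v \<in> ?W" using u v by (auto simp: comm_add_vec[OF v u])
      then have z: "?u + v = 0\<^sub>v d" using 1 by blast
      have neg: "a = (-1) \<cdot>\<^sub>v v" if "a + v = 0\<^sub>v d" "a \<in> carrier_vec d" for a
      proof (rule eq_vecI)
        fix l assume "l < dim_vec ((-1) \<cdot>\<^sub>v v)"
        then have "l < d" using v by simp
        then have "a $ l + v $ l = 0" using arg_cong[OF that(1), of "\<lambda>x. x $ l"] that(2) v by simp
        then show "a $ l = ((-1) \<cdot>\<^sub>v v) $ l" using \<open>l < d\<close> v by (simp add: eq_neg_iff_add_eq_0)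
      qed (use that v in auto)
      have "((-1) \<cdot>\<^sub>m 1\<^sub>m d) *\<^sub>v v = (-1) \<cdot>\<^sub>v v"
        using v by (intro eq_vecI) (auto simp: row_one)
      then show ?thesis using neg[OF z u] by simp
    qed
    then have "A = (-1) \<cdot>\<^sub>m 1\<^sub>m d" using A by (intro V.mat_eq_on_vecs) auto
    then show ?thesis ..
  next
    case 2
    have "A *\<^sub>v v = 1\<^sub>m d *\<^sub>v v" if "v \<in> carrier_vec d" for v
    proof -
      have "v \<in> ?W" using 2 that by blast
      then show ?thesis by simp
    qed
    then have "A = 1\<^sub>m d" using A by (intro V.mat_eq_on_vecs) auto
    then show ?thesis ..
  qed
qed

text \<open>The value at one inversion separates the classes: transvections map to one and all
  inversions to a common matrix, so this value determines the representation on the carrier.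
  Irreducibility leaves only plus and minus the identity for it.\<close>

theorem corollaryC:
  fixes n d :: nat
  assumes "n \<ge> 4" and "d \<ge> 1" and "int d \<le> 2 * \<lfloor>real n / 4\<rfloor> - 1"
  shows "finite ((irreps (AutoGroup (free_group n)) d :: (_ \<Rightarrow> 'k::alg_closed_field mat) set)
           // irreps_conj (AutoGroup (free_group n)) d)"
proof (rule finite_quotientI[OF equiv_irreps_conj, where f = "\<lambda>\<rho>. \<rho> (inversion n 0)"])
  let ?GL = "GL TYPE('k) d"
  interpret GL: group ?GL by (rule group_GL)
  have n0: "0 < n" using assms(1) by simp
  have hom: "group_hom (Aut n) ?GL \<rho>" if "\<rho> \<in> irreps (Aut n) d" for \<rho>
    using that by (simp add: irreps_def irreducible_rep_def group_hom_def group_hom_axioms_def group_Aut group_GL)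
  note tr = transvection_rep_trivial[OF assms hom]
  have inv: "\<rho> (inversion n i) = \<rho> (inversion n 0)" if "\<rho> \<in> irreps (Aut n) d" "i < n" for \<rho> :: "_ \<Rightarrow> 'k mat" and i
    using inversions_equal[OF hom[OF that(1)] tr[OF that(1)] that(2) n0] .
  have "\<rho> (inversion n 0) \<in> {1\<^sub>m d, (-1) \<cdot>\<^sub>m 1\<^sub>m d}" if \<rho>: "\<rho> \<in> irreps (Aut n) d" for \<rho> :: "_ \<Rightarrow> 'k mat"
  proof -
    interpret \<rho>: group_hom "Aut n" ?GL \<rho> by (rule hom[OF \<rho>])
    note e = inversion_closed[OF n0]
    have A: "\<rho> (inversion n 0) \<in> carrier ?GL" by (rule \<rho>.hom_closed[OF e])
    have A2: "\<rho> (inversion n 0) \<otimes>\<^bsub>?GL\<^esub> \<rho> (inversion n 0) = \<one>\<^bsub>?GL\<^esub>"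
      using \<rho>.hom_mult[OF e e] inversion_square[OF n0] by simp
    have "\<rho> \<phi> = 1\<^sub>m d \<or> \<rho> \<phi> = \<rho> (inversion n 0)" if "\<phi> \<in> carrier (Aut n)" for \<phi>
      using hom_two_values[OF hom[OF \<rho>] A A2 tr[OF \<rho>] inv[OF \<rho>] that] by (simp add: one_GL)
    then show ?thesis
      using irreducible_rep_sign[of "Aut n" d \<rho> "\<rho> (inversion n 0)"] \<rho> carrier_GL[OF A] A2
      by (auto simp: irreps_def mult_GL one_GL)
  qed
  then show "finite ((\<lambda>\<rho>. \<rho> (inversion n 0)) ` (irreps (Aut n) d :: (_ \<Rightarrow> 'k mat) set))"
    by (meson finite.emptyI finite.insertI finite_subset image_subsetI)
  fix \<rho> \<sigma> :: "(letter list \<Rightarrow> letter list) \<Rightarrow> 'k mat"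
  assume \<rho>: "\<rho> \<in> irreps (Aut n) d" and \<sigma>: "\<sigma> \<in> irreps (Aut n) d"
    and eq: "\<rho> (inversion n 0) = \<sigma> (inversion n 0)"
  interpret \<rho>: group_hom "Aut n" ?GL \<rho> by (rule hom[OF \<rho>])
  have "\<rho> \<phi> = \<sigma> \<phi>" if "\<phi> \<in> carrier (Aut n)" for \<phi>
  proof (rule homs_agree[OF hom[OF \<rho>] hom[OF \<sigma>] _ _ that])
    show "\<rho> (inversion n i) = \<sigma> (inversion n i)" if "i < n" for i
      using inv[OF \<rho> that] inv[OF \<sigma> that] eq by simp
  qed (simp add: tr[OF \<rho>] tr[OF \<sigma>])
  \<comment> \<open>The two functions may still differ off the carrier, which conjugacy ignores; the
    identity matrix conjugates one into the other.\<close>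
  then have "conjugate_reps (Aut n) d \<rho> \<sigma>"
    unfolding conjugate_reps_def using \<rho>.hom_closed by (intro bexI[of _ "\<one>\<^bsub>?GL\<^esub>"]) fastforce+
  then show "(\<rho>, \<sigma>) \<in> irreps_conj (Aut n) d" using \<rho> \<sigma> by (simp add: irreps_conj_def)
qed

end
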